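(* Let $N$, $n_i$, $m_i$ and disjoint label sets $\mathcal{E}_i\sqcup\mathcal{I}_i=[m_i]$ ($i\in[N]$) be given, and let $d_{i,j}>0$ ($i\in[N]$, $j\in[m_i]$) and $a_{i,j}>0$ ($i,j\in[N]$) be degrees. If each $g_{i,j}$ is a generic polynomial in $x_i$ of degree $d_{i,j}$ and each $f_i$ is a generic polynomial in $x=(x_1,\ldots,x_N)$ whose degree in $x_j$ is $a_{i,j}$, then Algorithm A of the context, applied to the Nash equilibrium problem with objectives $f_i$ and constraints $g_{i,j}$, terminates within finitely many loops: it either finds a Nash equilibrium if there exists any, or detects the nonexistence of Nash equilibria.
   Context: **Genericity.** A property holds for generic polynomials of the given (multi-)degrees if it holds for all coefficient vectors outside a set of Lebesgue measure zero in the (real) space of coefficients. Here $g_{i,j}$ ranges over polynomials in $\mathbb{R}[x_i]$ of degree at most $d_{i,j}$, and $f_i$ over polynomials in $\mathbb{R}[x]$ of degree at most $a_{i,j}$ in the block $x_j$ for each $j\in[N]$. **Nash equilibrium problem (NEP) of polynomials.** There are $N$ players; player $i$ has strategy $x_i\in\mathbb{R}^{n_i}$; $x=(x_1,\ldots,x_N)\in\mathbb{R}^n$, $n=n_1+\cdots+n_N$; $x_{-i}$ is the vector of all blocks except $x_i$, and one writes $x=(x_i,x_{-i})$. $[N]=\{1,\ldots,N\}$. Player $i$ has an objective $f_i\in\mathbb{R}[x]$ and constraining polynomials $g_{i,j}\in\mathbb{R}[x_i]$, $j\in[m_i]=\mathcal{E}_i\sqcup\mathcal{I}_i$, with feasible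 set $X_i=\{x_i\in\mathbb{R}^{n_i}: g_{i,j}(x_i)=0\ (j\in\mathcal{E}_i),\ g_{i,j}(x_i)\ge0\ (j\in\mathcal{I}_i)\}$. A Nash equilibrium (NE) is a point $x^*$ such that for every $i$, $x_i^*$ is a (global) minimizer of $f_i(\cdot,x_{-i}^* )$ over $X_i$. **Nonsingularity and multiplier expressions.** Let $G_i(x_i)$ be the $(n_i+m_i)\times m_i$ matrix polynomial whose top $n_i$ rows are $[\nabla_{x_i}g_{i,1}(x_i)\ \cdots\ \nabla_{x_i}g_{i,m_i}(x_i)]$ and whose bottom $m_i$ rows are $\mathrm{diag}(g_{i,1}(x_i),\ldots,g_{i,m_i}(x_i))$. The tuple $g_i=(g_{i,1},\ldots,g_{i,m_i})$ is nonsingular if $G_i(x_i)$ has full column rank for every $x_i\in\mathbb{C}^{n_i}$; this holds for generic $g_i$. In that case there is a matrix polynomial $H_i(x_i)$ with real coefficients such that $H_i(x_i)G_i(x_i)=I_{m_i}$; fix one. Let $\hat f_i(x)=(\nabla_{x_i}f_i(x),0,\ldots,0)\in\mathbb{R}^{n_i+m_i}$ and $\lambda_{i,j}(x):=(H_i(x_i)\hat f_i(x))_j$. **System (K).** For all $i\in[N]$: $\nabla_{x_i}f_i(x)-\sum_{j=1}^{m_i}\lambda_{i,j}(x)\nabla_{x_i}g_{i,j}(x_i)=0$; $g_{i,j}(x_i)=0$ for $j\in\mathcal{E}_i$; and $\lambda_{i,j}(x)g_{i,j}(x_i)=0$, $g_{i,j}(x_i)\ge0$, $\lambda_{i,j}(x)\ge0$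 for $j\in\mathcal{I}_i$. **Problem (U).** For finite sets $\mathcal{K}_i\subseteq X_i$, a symmetric positive definite $\Theta\in\mathbb{R}^{(n+1)\times(n+1)}$ and $[x]_1:=(1,x^T)^T\in\mathbb{R}^{n+1}$: minimize $[x]_1^T\Theta[x]_1$ over all $x\in\mathbb{R}^n$ satisfying (K) and $f_i(v,x_{-i})-f_i(x_i,x_{-i})\ge0$ for all $v\in\mathcal{K}_i$, $i\in[N]$. **Problem (L$_i(u)$).** For $u\in\mathbb{R}^n$: $\omega_i:=\min\{f_i(x_i,u_{-i})-f_i(u_i,u_{-i}): x_i\in X_i\}$. **Algorithm A** (all optimization problems are solved exactly; it is understood that each problem (L$_i(u)$) that is encountered has a minimizer). Step 0: set $\mathcal{K}_i:=\emptyset$ for all $i$, $\ell:=0$; choose a generic positive definite matrix $\Theta$ of size $n+1$ (generic: outside a set of Lebesgue measure zero). Step 1: solve (U). If it is infeasible, output that there is no NE and stop; otherwise let $u$ be an optimizer. Step 2: solve (L$_i(u)$) for each $i$. If all $\omega_i\ge0$, output the NE $u$ and stop; otherwise go to Step 3. Step 3: for each $i$ with $\omega_i<0$, obtain a nonempty finite set $U_i$ of some (not necessarily all) optimizers of (L$_i(u)$) and replace $\mathcal{K}_i$ by $\mathcal{K}_i\cup U_i$. Replace $\ell$ by $\ell+1$ and go to Step 1. *)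

theory Defs
  imports
    "HOL-Library.Poly_Mapping"
    "HOL-Analysis.Finite_Product_Measure"
    "HOL-Analysis.Lebesgue_Measure"
    "Jordan_Normal_Form.Matrix"
begin

unbundle no vec_syntax
unbundle no inner_syntax

text \<open>
  All index sets are 0-based: \<open>[N]\<close> is \<open>{..<N}\<close>, the coordinates of \<open>x\<^sub>i\<close> are \<open>{..<n i}\<close>, and the
  constraint labels of player \<open>i\<close> are \<open>{..<m i}\<close>.
\<close>

section \<open>Multivariate polynomials\<close>

text \<open>
  A monomial is a finitely supported exponent vector, a polynomial a finitely supported
  coefficient function on monomials; the ring operations are those of
  \<^theory>\<open>HOL-Library.Poly_Mapping\<close> (convolution product).
\<close>

type_synonym ('v, 'a) mpoly = "('v \<Rightarrow>\<^sub>0 nat) \<Rightarrow>\<^sub>0 'a"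

definition mp_eval :: "('v \<Rightarrow> 'a) \<Rightarrow> ('v, 'a::comm_semiring_1) mpoly \<Rightarrow> 'a" where
  "mp_eval x p = (\<Sum>\<mu>\<in>Poly_Mapping.keys p. Poly_Mapping.lookup p \<mu> *
     (\<Prod>v\<in>Poly_Mapping.keys \<mu>. x v ^ Poly_Mapping.lookup \<mu> v))"

text \<open>
  Formal partial derivative. The exponent \<open>\<mu> - single v 1\<close> is truncated at 0, but where truncation
  occurs the coefficient is 0.
\<close>

definition mp_deriv :: "'v \<Rightarrow> ('v, 'a::comm_semiring_1) mpoly \<Rightarrow> ('v, 'a) mpoly" where
  "mp_deriv v p = (\<Sum>\<mu>\<in>Poly_Mapping.keys p.
     Poly_Mapping.single (\<mu> - Poly_Mapping.single v 1)
       (of_nat (Poly_Mapping.lookup \<mu> v) * Poly_Mapping.lookup p \<mu>))"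

definition mp_vars :: "('v, 'a::zero) mpoly \<Rightarrow> 'v set" where
  "mp_vars p = (\<Union>\<mu>\<in>Poly_Mapping.keys p. Poly_Mapping.keys \<mu>)"

section \<open>Nash equilibrium problems of polynomials\<close>

text \<open>
  The variable \<open>(i, k)\<close> of an objective is the \<open>k\<close>-th coordinate of \<open>x\<^sub>i\<close>; the variable \<open>k\<close> of
  a constraint of player \<open>i\<close> is the \<open>k\<close>-th coordinate of \<open>x\<^sub>i\<close>.
\<close>

record poly_nep =
  players :: nat
  sdim :: "nat \<Rightarrow> nat"
  ncons :: "nat \<Rightarrow> nat"
  eqs :: "nat \<Rightarrow> nat set"
  ineqs :: "nat \<Rightarrow> nat set"
  objective :: "nat \<Rightarrow> (nat \<times> nat, real) mpoly"
  constr :: "nat \<Rightarrow> nat \<Rightarrow> (nat, real) mpoly"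

type_synonym profile = "nat \<Rightarrow> real vec"

definition profiles :: "poly_nep \<Rightarrow> profile set" where
  "profiles P = (\<Pi>\<^sub>E i\<in>{..<players P}. carrier_vec (sdim P i))"

definition total_dim :: "poly_nep \<Rightarrow> nat" where
  "total_dim P = (\<Sum>i<players P. sdim P i)"

abbreviation block_eval :: "real vec \<Rightarrow> (nat, real) mpoly \<Rightarrow> real" where
  "block_eval v p \<equiv> mp_eval (\<lambda>k. v $ k) p"

abbreviation profile_eval :: "profile \<Rightarrow> (nat \<times> nat, real) mpoly \<Rightarrow> real" where
  "profile_eval x p \<equiv> mp_eval (\<lambda>(i, k). x i $ k) p"

definition feasible_set :: "poly_nep \<Rightarrow> nat \<Rightarrow> real vec set" where
  "feasible_set P i = {v \<in> carrier_vec (sdim P i).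
     (\<forall>j\<in>eqs P i. block_eval v (constr P i j) = 0) \<and>
     (\<forall>j\<in>ineqs P i. block_eval v (constr P i j) \<ge> 0)}"

text \<open>The point \<open>(v, x\<^sub>-\<^sub>i)\<close> is \<open>x(i := v)\<close>.\<close>

definition nash_equilibrium :: "poly_nep \<Rightarrow> profile \<Rightarrow> bool" where
  "nash_equilibrium P x \<longleftrightarrow> x \<in> profiles P \<and>
     (\<forall>i<players P. x i \<in> feasible_set P i \<and>
        (\<forall>v\<in>feasible_set P i.
           profile_eval x (objective P i) \<le> profile_eval (x(i := v)) (objective P i)))"

section \<open>Lagrange multiplier expressions and system (K)\<close>

definition constr_matrix :: "poly_nep \<Rightarrow> nat \<Rightarrow> (nat, real) mpoly mat" where
  "constr_matrix P i = mat (sdim P i + ncons P i) (ncons P i)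
     (\<lambda>(r, j). if r < sdim P i then mp_deriv r (constr P i j)
               else if r - sdim P i = j then constr P i j else 0)"

definition left_inverses :: "poly_nep \<Rightarrow> (nat \<Rightarrow> (nat, real) mpoly mat) \<Rightarrow> bool" where
  "left_inverses P H \<longleftrightarrow> (\<forall>i<players P.
     H i \<in> carrier_mat (ncons P i) (sdim P i + ncons P i) \<and>
     (\<forall>p\<in>elements_mat (H i). mp_vars p \<subseteq> {..<sdim P i}) \<and>
     H i * constr_matrix P i = 1\<^sub>m (ncons P i))"

definition own_gradient :: "poly_nep \<Rightarrow> nat \<Rightarrow> profile \<Rightarrow> real vec" where
  "own_gradient P i x =
     vec (sdim P i) (\<lambda>k. profile_eval x (mp_deriv (i, k) (objective P i)))"

definition multipliers ::
  "poly_nep \<Rightarrow> (nat \<Rightarrow> (nat, real) mpoly mat) \<Rightarrow> nat \<Rightarrow> profile \<Rightarrow> real vec" where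
  "multipliers P H i x =
     map_mat (block_eval (x i)) (H i) *\<^sub>v (own_gradient P i x @\<^sub>v 0\<^sub>v (ncons P i))"

definition kkt_point :: "poly_nep \<Rightarrow> (nat \<Rightarrow> (nat, real) mpoly mat) \<Rightarrow> profile \<Rightarrow> bool" where
  "kkt_point P H x \<longleftrightarrow> x \<in> profiles P \<and>
     (\<forall>i<players P.
        (\<forall>k<sdim P i. own_gradient P i x $ k -
           (\<Sum>j<ncons P i. multipliers P H i x $ j *
              block_eval (x i) (mp_deriv k (constr P i j))) = 0) \<and>
        (\<forall>j\<in>eqs P i. block_eval (x i) (constr P i j) = 0) \<and>
        (\<forall>j\<in>ineqs P i.
           multipliers P H i x $ j * block_eval (x i) (constr P i j) = 0 \<and>
           block_eval (x i) (constr P i j) \<ge> 0 \<and>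
           multipliers P H i x $ j \<ge> 0))"

section \<open>Problems (U) and (L)\<close>

definition homogenized :: "poly_nep \<Rightarrow> profile \<Rightarrow> real vec" where
  "homogenized P x =
     vec_of_list (1 # concat (map (\<lambda>i. list_of_vec (x i)) [0..<players P]))"

definition U_objective :: "poly_nep \<Rightarrow> real mat \<Rightarrow> profile \<Rightarrow> real" where
  "U_objective P \<Theta> x = homogenized P x \<bullet> (\<Theta> *\<^sub>v homogenized P x)"

definition U_feasible ::
  "poly_nep \<Rightarrow> (nat \<Rightarrow> (nat, real) mpoly mat) \<Rightarrow> (nat \<Rightarrow> real vec set) \<Rightarrow> profile \<Rightarrow> bool" where
  "U_feasible P H K x \<longleftrightarrow> kkt_point P H x \<and>
     (\<forall>i<players P. \<forall>v\<in>K i.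
        profile_eval (x(i := v)) (objective P i) - profile_eval x (objective P i) \<ge> 0)"

definition U_optimizer ::
  "poly_nep \<Rightarrow> (nat \<Rightarrow> (nat, real) mpoly mat) \<Rightarrow> real mat \<Rightarrow> (nat \<Rightarrow> real vec set) \<Rightarrow> profile \<Rightarrow> bool"
  where
  "U_optimizer P H \<Theta> K u \<longleftrightarrow> U_feasible P H K u \<and>
     (\<forall>x. U_feasible P H K x \<longrightarrow> U_objective P \<Theta> u \<le> U_objective P \<Theta> x)"

definition L_objective :: "poly_nep \<Rightarrow> profile \<Rightarrow> nat \<Rightarrow> real vec \<Rightarrow> real" where
  "L_objective P u i v =
     profile_eval (u(i := v)) (objective P i) - profile_eval u (objective P i)"

definition L_optimizers :: "poly_nep \<Rightarrow> profile \<Rightarrow> nat \<Rightarrow> real vec set" where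
  "L_optimizers P u i = {v \<in> feasible_set P i.
     \<forall>w\<in>feasible_set P i. L_objective P u i v \<le> L_objective P u i w}"

text \<open>Only used where the infimum is attained, i.e. where \<open>L_optimizers P u i \<noteq> {}\<close>.\<close>

definition L_value :: "poly_nep \<Rightarrow> profile \<Rightarrow> nat \<Rightarrow> real" where
  "L_value P u i = Inf (L_objective P u i ` feasible_set P i)"

definition L_solvable :: "poly_nep \<Rightarrow> profile \<Rightarrow> bool" where
  "L_solvable P u \<longleftrightarrow> (\<forall>i<players P. L_optimizers P u i \<noteq> {})"

section \<open>The algorithm\<close>

text \<open>
  The algorithm is nondeterministic in the choice of the optimizer \<open>u\<close> and of the sets \<open>U\<^sub>i\<close>, hence
  a transition relation. \<open>Step1 l K\<close> and \<open>Step2 l K u\<close> are the states in which Step 1 resp. Step 2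
  is about to be executed, with loop counter \<open>l\<close> and finite sets \<open>K\<close>; Step 3 is the transition
  \<open>refine\<close>. A state \<open>Step2 l K u\<close> has no successor if some (L) problem at \<open>u\<close> has no minimizer.
\<close>

datatype alg_state =
    Step1 nat "nat \<Rightarrow> real vec set"
  | Step2 nat "nat \<Rightarrow> real vec set" profile
  | FoundNE profile
  | NoNE

definition alg_init :: alg_state where
  "alg_init = Step1 0 (\<lambda>_. {})"

inductive alg_step ::
  "poly_nep \<Rightarrow> (nat \<Rightarrow> (nat, real) mpoly mat) \<Rightarrow> real mat \<Rightarrow> alg_state \<Rightarrow> alg_state \<Rightarrow> bool"
  for P H \<Theta> where
  infeasible: "\<not> (\<exists>x. U_feasible P H K x) \<Longrightarrow> alg_step P H \<Theta> (Step1 l K) NoNE"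
| optimize: "U_optimizer P H \<Theta> K u \<Longrightarrow> alg_step P H \<Theta> (Step1 l K) (Step2 l K u)"
| accept: "L_solvable P u \<Longrightarrow> \<forall>i<players P. L_value P u i \<ge> 0 \<Longrightarrow>
    alg_step P H \<Theta> (Step2 l K u) (FoundNE u)"
| refine: "L_solvable P u \<Longrightarrow> \<exists>i<players P. L_value P u i < 0 \<Longrightarrow>
    \<forall>i<players P. L_value P u i < 0 \<longrightarrow>
      finite (U i) \<and> U i \<noteq> {} \<and> U i \<subseteq> L_optimizers P u i \<Longrightarrow>
    alg_step P H \<Theta> (Step2 l K u)
      (Step1 (Suc l) (\<lambda>i. if i < players P \<and> L_value P u i < 0 then K i \<union> U i else K i))"

definition alg_terminates ::
  "poly_nep \<Rightarrow> (nat \<Rightarrow> (nat, real) mpoly mat) \<Rightarrow> real mat \<Rightarrow> bool" where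
  "alg_terminates P H \<Theta> \<longleftrightarrow>
     \<not> (\<exists>\<sigma>. \<sigma> 0 = alg_init \<and> (\<forall>t::nat. alg_step P H \<Theta> (\<sigma> t) (\<sigma> (Suc t))))"

text \<open>
  Every run that cannot be continued has produced a correct output, unless it stopped at a point
  where some (L) problem has no minimizer. In particular, if (U) is feasible when it is
  encountered, then it has an optimizer.
\<close>

definition alg_correct ::
  "poly_nep \<Rightarrow> (nat \<Rightarrow> (nat, real) mpoly mat) \<Rightarrow> real mat \<Rightarrow> bool" where
  "alg_correct P H \<Theta> \<longleftrightarrow>
     (\<forall>s. (alg_step P H \<Theta>)\<^sup>*\<^sup>* alg_init s \<and> \<not> (\<exists>s'. alg_step P H \<Theta> s s') \<longrightarrow>
        (case s of
           FoundNE u \<Rightarrow> nash_equilibrium P u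
         | NoNE \<Rightarrow> \<not> (\<exists>x. nash_equilibrium P x)
         | Step2 l K u \<Rightarrow> \<not> L_solvable P u
         | Step1 l K \<Rightarrow> False))"

section \<open>Generic data\<close>

text \<open>
  The coefficient labels: \<open>FCoeff i \<mu>\<close> is the coefficient of \<open>\<mu>\<close> in \<open>f\<^sub>i\<close>, \<open>GCoeff i j \<mu>\<close> that of \<open>\<mu>\<close>
  in \<open>g\<^sub>i\<^sub>,\<^sub>j\<close>. The label set is finite, so the product of copies of \<^const>\<open>lborel\<close> over it is Lebesgue
  measure on the space of all coefficient vectors.
\<close>

definition f_monomials ::
  "nat \<Rightarrow> (nat \<Rightarrow> nat) \<Rightarrow> (nat \<Rightarrow> nat \<Rightarrow> nat) \<Rightarrow> nat \<Rightarrow> ((nat \<times> nat) \<Rightarrow>\<^sub>0 nat) set" where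
  "f_monomials N n a i = {\<mu>. Poly_Mapping.keys \<mu> \<subseteq> Sigma {..<N} (\<lambda>j. {..<n j}) \<and>
     (\<forall>j<N. (\<Sum>k<n j. Poly_Mapping.lookup \<mu> (j, k)) \<le> a i j)}"

definition g_monomials ::
  "(nat \<Rightarrow> nat) \<Rightarrow> (nat \<Rightarrow> nat \<Rightarrow> nat) \<Rightarrow> nat \<Rightarrow> nat \<Rightarrow> (nat \<Rightarrow>\<^sub>0 nat) set" where
  "g_monomials n d i j = {\<mu>. Poly_Mapping.keys \<mu> \<subseteq> {..<n i} \<and>
     (\<Sum>k<n i. Poly_Mapping.lookup \<mu> k) \<le> d i j}"

datatype coeff_label =
    FCoeff nat "(nat \<times> nat) \<Rightarrow>\<^sub>0 nat"
  | GCoeff nat nat "nat \<Rightarrow>\<^sub>0 nat"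

definition coeff_labels ::
  "nat \<Rightarrow> (nat \<Rightarrow> nat) \<Rightarrow> (nat \<Rightarrow> nat) \<Rightarrow> (nat \<Rightarrow> nat \<Rightarrow> nat) \<Rightarrow> (nat \<Rightarrow> nat \<Rightarrow> nat) \<Rightarrow> coeff_label set"
  where
  "coeff_labels N n m d a =
     {FCoeff i \<mu> | i \<mu>. i < N \<and> \<mu> \<in> f_monomials N n a i} \<union>
     {GCoeff i j \<mu> | i j \<mu>. i < N \<and> j < m i \<and> \<mu> \<in> g_monomials n d i j}"

definition coeff_measure ::
  "nat \<Rightarrow> (nat \<Rightarrow> nat) \<Rightarrow> (nat \<Rightarrow> nat) \<Rightarrow> (nat \<Rightarrow> nat \<Rightarrow> nat) \<Rightarrow> (nat \<Rightarrow> nat \<Rightarrow> nat) \<Rightarrow>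
    (coeff_label \<Rightarrow> real) measure" where
  "coeff_measure N n m d a = (\<Pi>\<^sub>M l\<in>coeff_labels N n m d a. lborel)"

definition nep_of_coeffs ::
  "nat \<Rightarrow> (nat \<Rightarrow> nat) \<Rightarrow> (nat \<Rightarrow> nat) \<Rightarrow> (nat \<Rightarrow> nat set) \<Rightarrow> (nat \<Rightarrow> nat set) \<Rightarrow>
    (nat \<Rightarrow> nat \<Rightarrow> nat) \<Rightarrow> (nat \<Rightarrow> nat \<Rightarrow> nat) \<Rightarrow> (coeff_label \<Rightarrow> real) \<Rightarrow> poly_nep" where
  "nep_of_coeffs N n m E I d a c =
     \<lparr>players = N, sdim = n, ncons = m, eqs = E, ineqs = I,
      objective = (\<lambda>i. \<Sum>\<mu>\<in>f_monomials N n a i. Poly_Mapping.single \<mu> (c (FCoeff i \<mu>))),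
      constr = (\<lambda>i j. \<Sum>\<mu>\<in>g_monomials n d i j. Poly_Mapping.single \<mu> (c (GCoeff i j \<mu>)))\<rparr>"

text \<open>Symmetric matrices of size \<open>s\<close> are parametrized by their entries on and above the diagonal.\<close>

definition sym_measure :: "nat \<Rightarrow> (nat \<times> nat \<Rightarrow> real) measure" where
  "sym_measure s = (\<Pi>\<^sub>M e\<in>{(p, q). p \<le> q \<and> q < s}. lborel)"

definition sym_mat :: "nat \<Rightarrow> (nat \<times> nat \<Rightarrow> real) \<Rightarrow> real mat" where
  "sym_mat s \<theta> = mat s s (\<lambda>(p, q). \<theta> (min p q, max p q))"

definition pos_definite :: "real mat \<Rightarrow> bool" where
  "pos_definite A \<longleftrightarrow> (\<forall>v\<in>carrier_vec (dim_row A). v \<noteq> 0\<^sub>v (dim_row A) \<longrightarrow> v \<bullet> (A *\<^sub>v v) > 0)"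

end

theory Submission
  imports Defs "HOL-Analysis.Function_Metric" "HOL-Computational_Algebra.Polynomial"
begin

text \<open>
  If only finitely many points satisfy (K), then each refinement cuts off at least one of them,
  and the algorithm terminates. So one needs that Nash equilibria satisfy (K) and
  that (K) has finitely many real solutions for almost all coefficients.

  For the latter, fix the active constraints. The equations \<open>\<nabla>f\<^sub>i - \<Sum>\<lambda>\<^sub>i\<^sub>,\<^sub>j \<nabla>g\<^sub>i\<^sub>,\<^sub>j = 0\<close>, \<open>g\<^sub>i\<^sub>,\<^sub>j = 0\<close> can be
  solved for as many coefficients (the linear ones of \<open>f\<^sub>i\<close> in \<open>x\<^sub>i\<close> and the constant ones of \<open>g\<^sub>i\<^sub>,\<^sub>j\<close>)
  as there are unknowns \<open>x\<close>, \<open>\<lambda>\<close>. Thus the solutions for the coefficient vector \<open>c\<close> form a fibre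
  \<open>\<Phi>(w) = c\<close> of a polynomial map between spaces of equal dimension. A coordinate \<open>x\<^sub>i\<^sub>,\<^sub>k\<close> is
  algebraically dependent on the components of \<open>\<Phi>\<close>: \<open>Q(x\<^sub>i\<^sub>,\<^sub>k, \<Phi>) = 0\<close> with \<open>Q \<noteq> 0\<close>. For almost
  all \<open>c\<close> the univariate polynomial \<open>Q(\<cdot>, c)\<close> is nonzero, so \<open>x\<^sub>i\<^sub>,\<^sub>k\<close> takes finitely many values.
\<close>

section \<open>Evaluation and differentiation of polynomials\<close>

definition mono_eval :: "('v \<Rightarrow> 'a::comm_semiring_1) \<Rightarrow> ('v \<Rightarrow>\<^sub>0 nat) \<Rightarrow> 'a" where
  "mono_eval x \<mu> = (\<Prod>v\<in>Poly_Mapping.keys \<mu>. x v ^ Poly_Mapping.lookup \<mu> v)"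

lemma mp_eval_mono: "mp_eval x p = (\<Sum>\<mu>\<in>Poly_Mapping.keys p. Poly_Mapping.lookup p \<mu> * mono_eval x \<mu>)"
  by (simp add: mp_eval_def mono_eval_def)

lemma mono_eval_superset:
  assumes "finite S" "Poly_Mapping.keys \<mu> \<subseteq> S"
  shows "mono_eval x \<mu> = (\<Prod>v\<in>S. x v ^ Poly_Mapping.lookup \<mu> v)"
  unfolding mono_eval_def using assms by (intro prod.mono_neutral_left) (auto simp: in_keys_iff)

lemma mono_eval_add: "mono_eval x (\<mu> + \<nu>) = mono_eval x \<mu> * mono_eval x \<nu>"
proof -
  let ?S = "Poly_Mapping.keys \<mu> \<union> Poly_Mapping.keys \<nu>"
  have "mono_eval x (\<mu> + \<nu>) = (\<Prod>v\<in>?S. x v ^ Poly_Mapping.lookup (\<mu> + \<nu>) v)"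
    by (rule mono_eval_superset) (use keys_add[of \<mu> \<nu>] in auto)
  also have "\<dots> = mono_eval x \<mu> * mono_eval x \<nu>"
    by (simp add: mono_eval_superset[of ?S \<mu>] mono_eval_superset[of ?S \<nu>] lookup_add power_add
        prod.distrib)
  finally show ?thesis .
qed

lemma mp_eval_superset:
  assumes "finite S" "Poly_Mapping.keys p \<subseteq> S"
  shows "mp_eval x p = (\<Sum>\<mu>\<in>S. Poly_Mapping.lookup p \<mu> * mono_eval x \<mu>)"
  unfolding mp_eval_mono using assms by (intro sum.mono_neutral_left) (auto simp: in_keys_iff)

lemma mp_eval_zero [simp]: "mp_eval x 0 = 0"
  by (simp add: mp_eval_def)

lemma mp_eval_single [simp]: "mp_eval x (Poly_Mapping.single \<mu> c) = c * mono_eval x \<mu>"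
  by (simp add: mp_eval_mono)

lemma mono_eval_zero [simp]: "mono_eval x 0 = 1"
  by (simp add: mono_eval_def)

lemma mp_eval_one [simp]: "mp_eval x 1 = 1"
  using mp_eval_single[of x 0 1] by simp

lemma mp_eval_add: "mp_eval x (p + q) = mp_eval x p + mp_eval x q"
proof -
  let ?S = "Poly_Mapping.keys p \<union> Poly_Mapping.keys q"
  have "mp_eval x (p + q) = (\<Sum>\<mu>\<in>?S. Poly_Mapping.lookup (p + q) \<mu> * mono_eval x \<mu>)"
    by (rule mp_eval_superset) (use keys_add[of p q] in auto)
  also have "\<dots> = mp_eval x p + mp_eval x q"
    by (simp add: mp_eval_superset[of ?S p] mp_eval_superset[of ?S q] lookup_add distrib_right
        sum.distrib)
  finally show ?thesis .
qed

lemma mp_eval_sum: "mp_eval x (\<Sum>i\<in>A. p i) = (\<Sum>i\<in>A. mp_eval x (p i))"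
  by (induction A rule: infinite_finite_induct) (auto simp: mp_eval_add)

lemma poly_mapping_sum_single:
  "p = (\<Sum>\<mu>\<in>Poly_Mapping.keys p. Poly_Mapping.single \<mu> (Poly_Mapping.lookup p \<mu>))"
  by (rule poly_mapping_eqI) (auto simp: lookup_sum lookup_single when_def in_keys_iff)

lemma mp_eval_mult: "mp_eval x (p * q) = mp_eval x p * mp_eval x q"
proof -
  have "mp_eval x (p * q) = mp_eval x
      ((\<Sum>\<mu>\<in>Poly_Mapping.keys p. Poly_Mapping.single \<mu> (Poly_Mapping.lookup p \<mu>)) *
       (\<Sum>\<nu>\<in>Poly_Mapping.keys q. Poly_Mapping.single \<nu> (Poly_Mapping.lookup q \<nu>)))"
    by (simp flip: poly_mapping_sum_single)
  also have "\<dots> = mp_eval x p * mp_eval x q"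
    by (simp add: sum_product mult_single mp_eval_sum mono_eval_add)
      (simp add: mp_eval_mono sum_product mult_ac)
  finally show ?thesis .
qed

lemma mp_eval_prod: "mp_eval x (\<Prod>i\<in>A. p i) = (\<Prod>i\<in>A. mp_eval x (p i))"
  by (induction A rule: infinite_finite_induct) (auto simp: mp_eval_mult)

lemma mp_eval_power: "mp_eval x (p ^ k) = mp_eval x p ^ k"
  by (induction k) (auto simp: mp_eval_mult)

lemma mp_eval_cong:
  assumes "\<And>v. v \<in> mp_vars p \<Longrightarrow> x v = y v"
  shows "mp_eval x p = mp_eval y p"
  unfolding mp_eval_def using assms
  by (intro sum.cong refl arg_cong2[of _ _ _ _ "(*)"] prod.cong)
    (use assms in \<open>fastforce simp: mp_vars_def\<close>)+

lemma mono_eval_cong: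
  "(\<And>v. v \<in> Poly_Mapping.keys \<mu> \<Longrightarrow> x v = y v) \<Longrightarrow> mono_eval x \<mu> = mono_eval y \<mu>"
  by (simp add: mono_eval_def)

lemma keys_diff_subset: "Poly_Mapping.keys (\<mu> - \<nu> :: 'v \<Rightarrow>\<^sub>0 nat) \<subseteq> Poly_Mapping.keys \<mu>"
  by (auto simp: in_keys_iff lookup_minus)

lemma mp_vars_add: "mp_vars (p + q) \<subseteq> mp_vars p \<union> mp_vars q"
  using keys_add[of p q] by (auto simp: mp_vars_def)

lemma mp_vars_mult: "mp_vars (p * q) \<subseteq> mp_vars p \<union> mp_vars q"
proof
  fix v assume "v \<in> mp_vars (p * q)"
  then obtain \<mu> where "\<mu> \<in> Poly_Mapping.keys (p * q)" "v \<in> Poly_Mapping.keys \<mu>"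
    by (auto simp: mp_vars_def)
  moreover from this obtain \<alpha> \<beta> where "\<mu> = \<alpha> + \<beta>" "\<alpha> \<in> Poly_Mapping.keys p"
    "\<beta> \<in> Poly_Mapping.keys q"
    using keys_mult[of p q] by blast
  ultimately show "v \<in> mp_vars p \<union> mp_vars q"
    using keys_add[of \<alpha> \<beta>] by (auto simp: mp_vars_def)
qed

lemma mp_eval_deriv_superset:
  assumes "finite S" "Poly_Mapping.keys p \<subseteq> S"
  shows "mp_eval x (mp_deriv k p) = (\<Sum>\<mu>\<in>S. of_nat (Poly_Mapping.lookup \<mu> k) *
    Poly_Mapping.lookup p \<mu> * mono_eval x (\<mu> - Poly_Mapping.single k 1))"
  unfolding mp_deriv_def mp_eval_sum mp_eval_single using assms
  by (intro sum.mono_neutral_left) (auto simp: in_keys_iff)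

lemma mono_eval_has_field_derivative:
  fixes x :: "'v \<Rightarrow> real"
  shows "((\<lambda>t. mono_eval (x(k := t)) \<mu>) has_field_derivative
    of_nat (Poly_Mapping.lookup \<mu> k) * mono_eval x (\<mu> - Poly_Mapping.single k 1)) (at (x k))"
proof -
  \<comment> \<open>Adding \<open>k\<close> to the support lets the factor at \<open>k\<close> be
    split off even when its exponent is 0. In that case the truncated exponent in \<open>eq'\<close>
    is harmless, since the derivative carries the factor 0.\<close>
  let ?S = "insert k (Poly_Mapping.keys \<mu>)"
  let ?R = "Poly_Mapping.keys \<mu> - {k}"
  let ?C = "\<Prod>v\<in>?R. x v ^ Poly_Mapping.lookup \<mu> v"
  have eq: "mono_eval (x(k := t)) \<mu> = t ^ Poly_Mapping.lookup \<mu> k * ?C" for t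
    by (subst mono_eval_superset[of ?S])
      (auto simp: prod.insert_remove intro!: prod.cong)
  have eq': "mono_eval x (\<mu> - Poly_Mapping.single k 1) = x k ^ (Poly_Mapping.lookup \<mu> k - 1) * ?C"
    by (subst mono_eval_superset[of ?S])
      (auto simp: prod.insert_remove in_keys_iff lookup_minus lookup_single when_def intro!: prod.cong)
  show ?thesis
    unfolding eq eq' by (auto intro!: derivative_eq_intros)
qed

lemma mp_eval_has_field_derivative:
  fixes x :: "'v \<Rightarrow> real"
  shows "((\<lambda>t. mp_eval (x(k := t)) p) has_field_derivative mp_eval x (mp_deriv k p)) (at (x k))"
proof -
  have "((\<lambda>t. mp_eval (x(k := t)) p) has_field_derivative
      (\<Sum>\<mu>\<in>Poly_Mapping.keys p. Poly_Mapping.lookup p \<mu> *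
        (of_nat (Poly_Mapping.lookup \<mu> k) * mono_eval x (\<mu> - Poly_Mapping.single k 1)))) (at (x k))"
    unfolding mp_eval_mono
    by (intro DERIV_sum DERIV_cmult mono_eval_has_field_derivative)
  then show ?thesis
    by (simp add: mp_eval_deriv_superset[of "Poly_Mapping.keys p"] mult_ac)
qed

lemma continuous_on_mp_eval:
  assumes "\<And>v. continuous_on S (\<lambda>x. f x v)"
  shows "continuous_on S (\<lambda>x. mp_eval (f x) p :: real)"
  unfolding mp_eval_def by (intro continuous_intros assms)

section \<open>Algebraic dependence\<close>

text \<open>Gaussian elimination, one coordinate of \<open>S\<close> at a time: a vector with a
  nonzero entry at \<open>s\<close> serves as pivot and is given up together with \<open>s\<close>,
  so the strict inequality of cardinalities survives.\<close>

lemma linear_relation: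
  fixes v :: "'i \<Rightarrow> 's \<Rightarrow> real"
  assumes "finite S" "finite I" "card S < card I"
  shows "\<exists>c. (\<exists>i\<in>I. c i \<noteq> 0) \<and> (\<forall>s\<in>S. (\<Sum>i\<in>I. c i * v i s) = 0)"
  using assms
proof (induction S arbitrary: I v rule: finite_induct)
  case empty
  then have "I \<noteq> {}" by auto
  then show ?case by (intro exI[of _ "\<lambda>_. 1"]) auto
next
  case (insert s S)
  show ?case
  proof (cases "\<exists>j\<in>I. v j s \<noteq> 0")
    case False
    with insert.IH[of I v] insert.hyps insert.prems show ?thesis by auto
  next
    case True
    then obtain j where j: "j \<in> I" "v j s \<noteq> 0" by blast
    let ?I = "I - {j}"
    \<comment> \<open>Subtracting a multiple of the pivot \<open>v j\<close> makes the entry at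
      \<open>s\<close> vanish.\<close>
    define w where "w i t = v i t - v i s / v j s * v j t" for i t
    have "card S < card ?I"
      using insert.hyps insert.prems j by simp
    from insert.IH[OF _ this, of w] insert.prems obtain c where
      c: "\<exists>i\<in>?I. c i \<noteq> 0" "\<forall>t\<in>S. (\<Sum>i\<in>?I. c i * w i t) = 0" by auto
    \<comment> \<open>The pivot receives all subtracted multiples, so that the combination of the
      \<open>v i\<close> equals that of the \<open>w i\<close>.\<close>
    define c' where "c' = c(j := - (\<Sum>i\<in>?I. c i * (v i s / v j s)))"
    have sum_c': "(\<Sum>i\<in>I. c' i * v i t) = (\<Sum>i\<in>?I. c i * w i t)" for t
    proof -
      have "(\<Sum>i\<in>I. c' i * v i t) = c' j * v j t + (\<Sum>i\<in>?I. c' i * v i t)"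
        using j insert.prems by (simp add: sum.remove)
      also have "(\<Sum>i\<in>?I. c' i * v i t) = (\<Sum>i\<in>?I. c i * v i t)"
        by (intro sum.cong) (auto simp: c'_def)
      finally show ?thesis
        by (simp add: c'_def w_def right_diff_distrib sum_subtractf sum_distrib_left sum_distrib_right
            mult_ac)
    qed
    have "\<exists>i\<in>I. c' i \<noteq> 0" using c(1) by (auto simp: c'_def)
    moreover have "\<forall>t\<in>insert s S. (\<Sum>i\<in>I. c' i * v i t) = 0"
      using c(2) j by (auto simp: sum_c') (simp add: w_def)
    ultimately show ?thesis by blast
  qed
qed

section \<open>Counting monomials with bounded exponents\<close>

definition exponents :: "'v set \<Rightarrow> nat \<Rightarrow> ('v \<Rightarrow>\<^sub>0 nat) set" where
  "exponents V D = {\<mu>. Poly_Mapping.keys \<mu> \<subseteq> V \<and> (\<forall>v\<in>V. Poly_Mapping.lookup \<mu> v \<le> D)}"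

text \<open>Bounding each exponent separately, not the total degree, makes the set embed into the
  functions from \<open>V\<close> to \<open>{..D}\<close>, which are easy to count.\<close>

lemma exponents_card:
  assumes "finite V"
  shows "finite (exponents V D)" "card (exponents V D) \<le> (D + 1) ^ card V"
proof -
  let ?f = "\<lambda>\<mu>. restrict (Poly_Mapping.lookup \<mu>) V"
  have inj: "inj_on ?f (exponents V D)"
  proof (rule inj_onI, rule poly_mapping_eqI)
    fix \<mu> \<nu> v assume *: "\<mu> \<in> exponents V D" "\<nu> \<in> exponents V D" "?f \<mu> = ?f \<nu>"
    show "Poly_Mapping.lookup \<mu> v = Poly_Mapping.lookup \<nu> v"
    proof (cases "v \<in> V")
      case True
      then show ?thesis using fun_cong[OF *(3), of v] by simp
    next
      case False
      then have "v \<notin> Poly_Mapping.keys \<mu>" "v \<notin> Poly_Mapping.keys \<nu>"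
        using *(1,2) by (auto simp: exponents_def)
      then show ?thesis by (simp add: in_keys_iff)
    qed
  qed
  have sub: "?f ` exponents V D \<subseteq> (\<Pi>\<^sub>E v\<in>V. {..D})"
    by (auto simp: exponents_def)
  have fin: "finite (\<Pi>\<^sub>E v\<in>V. {..D})"
    using assms by (intro finite_PiE) auto
  show "finite (exponents V D)"
    using inj sub fin by (meson finite_imageD finite_subset)
  have "card (exponents V D) \<le> card (\<Pi>\<^sub>E v\<in>V. {..D})"
    using inj sub fin by (rule card_inj_on_le)
  also have "\<dots> = (D + 1) ^ card V" using assms by (simp add: card_PiE)
  finally show "card (exponents V D) \<le> (D + 1) ^ card V" .
qed

lemma exponents_add:
  assumes "\<mu> \<in> exponents V D" "\<nu> \<in> exponents V D'"
  shows "\<mu> + \<nu> \<in> exponents V (D + D')"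
  using assms keys_add[of \<mu> \<nu>] unfolding exponents_def by (auto simp: lookup_add intro: add_mono)

lemma exponents_mono: "D \<le> D' \<Longrightarrow> exponents V D \<subseteq> exponents V D'"
  unfolding exponents_def using order_trans by blast

lemma keys_mult_exponents:
  assumes "Poly_Mapping.keys p \<subseteq> exponents V D" "Poly_Mapping.keys q \<subseteq> exponents V D'"
  shows "Poly_Mapping.keys (p * q) \<subseteq> exponents V (D + D')"
proof
  fix \<mu> assume "\<mu> \<in> Poly_Mapping.keys (p * q)"
  then obtain \<alpha> \<beta> where "\<mu> = \<alpha> + \<beta>" "\<alpha> \<in> Poly_Mapping.keys p" "\<beta> \<in> Poly_Mapping.keys q"
    using keys_mult[of p q] by blast
  then show "\<mu> \<in> exponents V (D + D')"
    using assms exponents_add by blast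
qed

lemma keys_power_exponents:
  fixes p :: "('v, 'a::comm_semiring_1) mpoly"
  assumes "Poly_Mapping.keys p \<subseteq> exponents V D"
  shows "Poly_Mapping.keys (p ^ k) \<subseteq> exponents V (k * D)"
proof (induction k)
  case 0
  have "Poly_Mapping.keys (1 :: ('v, 'a) mpoly) \<subseteq> {0}"
    by simp
  then show ?case by (auto simp: exponents_def)
next
  case (Suc k)
  then show ?case using keys_mult_exponents[OF assms Suc.IH] by (simp add: add.commute)
qed

lemma keys_prod_exponents:
  fixes p :: "'i \<Rightarrow> ('v, 'a::comm_semiring_1) mpoly"
  assumes "finite A" "\<And>i. i \<in> A \<Longrightarrow> Poly_Mapping.keys (p i) \<subseteq> exponents V D"
  shows "Poly_Mapping.keys (\<Prod>i\<in>A. p i) \<subseteq> exponents V (card A * D)"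
  using assms
proof (induction A rule: finite_induct)
  case empty
  have "Poly_Mapping.keys (1 :: ('v, 'a) mpoly) \<subseteq> {0}"
    by simp
  then show ?case by (auto simp: exponents_def)
next
  case (insert i A)
  then show ?case using keys_mult_exponents[of "p i" V D "prod p A" "card A * D"] by simp
qed

lemma exists_exponents_bound:
  assumes "finite V" "mp_vars p \<subseteq> V"
  shows "\<exists>D. Poly_Mapping.keys p \<subseteq> exponents V D"
proof -
  let ?A = "(\<lambda>(\<mu>, v). Poly_Mapping.lookup \<mu> v) ` (Poly_Mapping.keys p \<times> V)"
  have "finite ?A" using assms by auto
  then have "\<forall>\<mu>\<in>Poly_Mapping.keys p. \<forall>v\<in>V. Poly_Mapping.lookup \<mu> v \<le> Max ?A"
    by (auto intro!: Max_ge)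
  then show ?thesis
    using assms(2) by (intro exI[of _ "Max ?A"]) (auto simp: exponents_def mp_vars_def)
qed

text \<open>
  The products \<open>h ^ j * (\<Prod>l. \<Phi> l ^ e l)\<close> with all exponents below \<open>B\<close> number
  \<open>B ^ (card V + 1)\<close>, but they live in a space whose dimension grows only like \<open>B ^ card V\<close>.
\<close>

lemma algebraic_dependence:
  fixes \<Phi> :: "'v \<Rightarrow> ('v, real) mpoly" and h :: "('v, real) mpoly"
  assumes fin: "finite V" and \<Phi>: "\<And>l. l \<in> V \<Longrightarrow> mp_vars (\<Phi> l) \<subseteq> V" and h: "mp_vars h \<subseteq> V"
  obtains B C where "\<exists>j<B. \<exists>e\<in>V \<rightarrow>\<^sub>E {..<B}. C j e \<noteq> (0::real)"
    "\<And>w. (\<Sum>j<B. (\<Sum>e\<in>V \<rightarrow>\<^sub>E {..<B}. C j e * (\<Prod>l\<in>V. mp_eval w (\<Phi> l) ^ e l)) * mp_eval w h ^ j) = 0"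
proof -
  let ?k = "card V"
  have "\<exists>D. \<forall>l\<in>V. Poly_Mapping.keys (\<Phi> l) \<subseteq> exponents V (D l)"
    by (intro bchoice ballI) (use exists_exponents_bound[OF fin \<Phi>] in auto)
  then obtain D1 where D1: "\<And>l. l \<in> V \<Longrightarrow> Poly_Mapping.keys (\<Phi> l) \<subseteq> exponents V (D1 l)" by blast
  obtain D2 where D2: "Poly_Mapping.keys h \<subseteq> exponents V D2"
    using exists_exponents_bound[OF fin h] by blast
  define D where "D = sum D1 V + D2"
  have D\<Phi>: "Poly_Mapping.keys (\<Phi> l) \<subseteq> exponents V D" if "l \<in> V" for l
  proof -
    have "D1 l \<le> D" using that fin member_le_sum[of l V D1] by (simp add: D_def)
    then show ?thesis using D1[OF that] exponents_mono by blast
  qed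
  have Dh: "Poly_Mapping.keys h \<subseteq> exponents V D"
    using D2 exponents_mono[of D2 D V] by (auto simp: D_def)
  \<comment> \<open>With \<open>k = card V\<close>, all products have exponents at most
    \<open>(k + 1) * (B * D)\<close>, so they involve at most
    \<open>(B * ((k + 1) * D + 1)) ^ k = B ^ k * (B - 1)\<close> monomials. This is less than the
    number \<open>B ^ (k + 1)\<close> of products.\<close>
  define B where "B = ((?k + 1) * D + 1) ^ ?k + 1"
  define T where "T = {..<B} \<times> (V \<rightarrow>\<^sub>E {..<B})"
  define S where "S = exponents V ((?k + 1) * (B * D))"
  define P where "P = (\<lambda>(j, e). (\<Prod>l\<in>V. \<Phi> l ^ e l) * h ^ j)"
  have "finite T" using fin by (auto simp: T_def intro: finite_PiE)
  have "finite S" using exponents_card(1)[OF fin] by (simp add: S_def)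
  have "card S \<le> ((?k + 1) * (B * D) + 1) ^ ?k"
    unfolding S_def using exponents_card(2)[OF fin] .
  also have "\<dots> \<le> (B * ((?k + 1) * D + 1)) ^ ?k"
    by (intro power_mono) (auto simp: B_def algebra_simps)
  also have "\<dots> = B ^ ?k * ((?k + 1) * D + 1) ^ ?k"
    by (rule power_mult_distrib)
  also have "\<dots> < B ^ ?k * B"
    by (simp add: B_def)
  also have "\<dots> = card T"
    using fin by (simp add: T_def card_cartesian_product card_PiE mult.commute)
  finally have card: "card S < card T" .
  have keys: "Poly_Mapping.keys (P z) \<subseteq> S" if "z \<in> T" for z
  proof -
    obtain j e where z: "z = (j, e)" by (cases z)
    have pow: "Poly_Mapping.keys (p ^ r) \<subseteq> exponents V (B * D)"
      if "Poly_Mapping.keys p \<subseteq> exponents V D" "r < B" for p :: "('v, real) mpoly" and r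
    proof -
      have "r * D \<le> B * D" using that by (intro mult_right_mono) auto
      then show ?thesis
        using keys_power_exponents[OF that(1), of r] exponents_mono by blast
    qed
    have "Poly_Mapping.keys (\<Prod>l\<in>V. \<Phi> l ^ e l) \<subseteq> exponents V (?k * (B * D))"
      using \<open>z \<in> T\<close> z by (intro keys_prod_exponents fin pow D\<Phi>) (auto simp: T_def PiE_def Pi_def)
    moreover have "Poly_Mapping.keys (h ^ j) \<subseteq> exponents V (B * D)"
      using \<open>z \<in> T\<close> z by (intro pow Dh) (auto simp: T_def)
    ultimately show ?thesis
      using keys_mult_exponents[of "\<Prod>l\<in>V. \<Phi> l ^ e l" V "?k * (B * D)" "h ^ j" "B * D"]
      by (simp add: z P_def S_def add.commute)
  qed
  \<comment> \<open>The vectors are the coefficient families of the products; a relation between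
    them is a relation between the polynomials.\<close>
  obtain c where c: "\<exists>z\<in>T. c z \<noteq> 0" "\<forall>s\<in>S. (\<Sum>z\<in>T. c z * Poly_Mapping.lookup (P z) s) = 0"
    using linear_relation[OF \<open>finite S\<close> \<open>finite T\<close> card, of "\<lambda>z. Poly_Mapping.lookup (P z)"] by blast
  have "(\<Sum>z\<in>T. c z * mp_eval w (P z)) = 0" for w
  proof -
    have "(\<Sum>z\<in>T. c z * mp_eval w (P z)) =
        (\<Sum>z\<in>T. c z * (\<Sum>s\<in>S. Poly_Mapping.lookup (P z) s * mono_eval w s))"
      by (intro sum.cong refl arg_cong2[of _ _ _ _ "(*)"] mp_eval_superset \<open>finite S\<close> keys)
    also have "\<dots> = (\<Sum>s\<in>S. (\<Sum>z\<in>T. c z * Poly_Mapping.lookup (P z) s) * mono_eval w s)"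
      unfolding sum_distrib_left sum_distrib_right by (subst sum.swap) (simp add: mult_ac)
    also have "\<dots> = 0" using c(2) by simp
    finally show ?thesis .
  qed
  moreover have "(\<Sum>j<B. (\<Sum>e\<in>V \<rightarrow>\<^sub>E {..<B}. c (j, e) * (\<Prod>l\<in>V. mp_eval w (\<Phi> l) ^ e l)) * mp_eval w h ^ j) =
      (\<Sum>z\<in>T. c z * mp_eval w (P z))" for w
    by (simp add: T_def P_def sum.cartesian_product case_prod_unfold mp_eval_mult mp_eval_prod
        mp_eval_power sum_distrib_left mult_ac)
  ultimately have "(\<Sum>j<B. (\<Sum>e\<in>V \<rightarrow>\<^sub>E {..<B}. c (j, e) * (\<Prod>l\<in>V. mp_eval w (\<Phi> l) ^ e l)) * mp_eval w h ^ j) = 0" for w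
    by simp
  then show ?thesis
    using c(1) by (intro that[of B "\<lambda>j e. c (j, e)"]) (auto simp: T_def)
qed

section \<open>Generic fibres of polynomial maps\<close>

text \<open>Induction on the number of variables: as a polynomial in the new variable,
  \<open>F\<close> has a coefficient that is nonzero for almost all values of the others. For these
  only finitely many values of the new variable are zeros, and Tonelli's theorem concludes.\<close>

lemma AE_polynomial_nonzero:
  fixes q :: "('v \<Rightarrow> nat) \<Rightarrow> real"
  assumes "finite V" "\<exists>e\<in>V \<rightarrow>\<^sub>E {..<B}. q e \<noteq> 0"
  shows "AE c in (\<Pi>\<^sub>M l\<in>V. lborel). (\<Sum>e\<in>V \<rightarrow>\<^sub>E {..<B}. q e * (\<Prod>l\<in>V. c l ^ e l)) \<noteq> 0"
  using assms
proof (induction V arbitrary: q rule: finite_induct)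
  case empty
  then show ?case by simp
next
  case (insert l V)
  interpret product_sigma_finite "\<lambda>_::'v. lborel :: real measure"
    by standard
  let ?M = "\<Pi>\<^sub>M l\<in>V. (lborel :: real measure)"
  let ?M' = "\<Pi>\<^sub>M l\<in>insert l V. (lborel :: real measure)"
  define F where "F c = (\<Sum>e\<in>insert l V \<rightarrow>\<^sub>E {..<B}. q e * (\<Prod>l\<in>insert l V. c l ^ e l))" for c
  define r where "r j c = (\<Sum>e\<in>V \<rightarrow>\<^sub>E {..<B}. q (e(l := j)) * (\<Prod>l\<in>V. c l ^ e l))" for j c
  have F_eq: "F (c(l := t)) = (\<Sum>j<B. r j c * t ^ j)" for c t
  proof -
    have *: "(\<Prod>i\<in>insert l V. (c(l := t)) i ^ (e(l := j)) i) = t ^ j * (\<Prod>i\<in>V. c i ^ e i)" for j e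
    proof -
      have "(\<Prod>i\<in>V. (c(l := t)) i ^ (e(l := j)) i) = (\<Prod>i\<in>V. c i ^ e i)"
        using insert.hyps by (intro prod.cong) auto
      then show ?thesis using insert.hyps by simp
    qed
    have inj: "inj_on (\<lambda>(j, e). e(l := j)) ({..<B} \<times> (V \<rightarrow>\<^sub>E {..<B}))"
      using inj_combinator[OF insert.hyps(2), of "\<lambda>_. {..<B}"] .
    have "F (c(l := t)) = (\<Sum>(j, e)\<in>{..<B} \<times> (V \<rightarrow>\<^sub>E {..<B}).
        q (e(l := j)) * (\<Prod>i\<in>insert l V. (c(l := t)) i ^ (e(l := j)) i))"
      unfolding F_def PiE_insert_eq by (subst sum.reindex[OF inj]) (simp add: case_prod_unfold)
    also have "\<dots> = (\<Sum>j<B. r j c * t ^ j)"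
      unfolding * by (simp add: sum.cartesian_product[symmetric] r_def sum_distrib_left mult_ac)
    finally show ?thesis .
  qed
  from insert.prems obtain e where e: "e \<in> insert l V \<rightarrow>\<^sub>E {..<B}" "q e \<noteq> 0" by blast
  \<comment> \<open>Functions in \<open>PiE\<close> are \<open>undefined\<close> outside their
    domain, so the entry at \<open>l\<close> is reset to that default.\<close>
  let ?e = "e(l := undefined)"
  have "\<exists>e'\<in>V \<rightarrow>\<^sub>E {..<B}. q (e'(l := e l)) \<noteq> 0"
    using e insert.hyps by (intro bexI[of _ ?e]) (auto simp: PiE_iff extensional_def)
  from insert.IH[OF this] have nz: "AE c in ?M. r (e l) c \<noteq> 0"
    unfolding r_def .
  have null: "AE t in lborel. F (c(l := t)) \<noteq> 0" if "r (e l) c \<noteq> 0" for c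
  proof -
    define p where "p = (\<Sum>j<B. monom (r j c) j)"
    have "e l < B" using e by (auto simp: PiE_iff)
    then have "coeff p (e l) = r (e l) c" by (simp add: p_def coeff_sum)
    then have "p \<noteq> 0" using that by auto
    have "poly p t = F (c(l := t))" for t
      by (simp add: p_def F_eq poly_sum poly_monom)
    then have "{t. F (c(l := t)) = 0} = {t. poly p t = 0}" by simp
    then have "countable {t. F (c(l := t)) = 0}"
      using poly_roots_finite[OF \<open>p \<noteq> 0\<close>] by (simp add: countable_finite)
    then have "AE t in lborel. t \<notin> {t. F (c(l := t)) = 0}"
      by (intro AE_not_in countable_imp_null_set_lborel)
    then show ?thesis by simp
  qed
  have meas: "F \<in> borel_measurable ?M'"
    unfolding F_def by measurable
  let ?Z = "{c\<in>space ?M'. F c = 0}"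
  have Z: "?Z \<in> sets ?M'" using meas by measurable
  \<comment> \<open>The zero set is measured by slicing along the variable \<open>l\<close>; almost
    every slice is finite and hence null.\<close>
  have "emeasure ?M' ?Z = (\<integral>\<^sup>+ c. indicator ?Z c \<partial>?M')"
    using Z by simp
  also have "\<dots> = (\<integral>\<^sup>+ c. (\<integral>\<^sup>+ t. indicator ?Z (c(l := t)) \<partial>lborel) \<partial>?M)"
    using Z by (intro product_nn_integral_insert insert.hyps) auto
  also have "\<dots> = (\<integral>\<^sup>+ c. 0 \<partial>?M)"
  proof (rule nn_integral_cong_AE, use nz in eventually_elim)
    case (elim c)
    have "(\<integral>\<^sup>+ t. indicator ?Z (c(l := t)) \<partial>lborel) = (\<integral>\<^sup>+ t. 0 \<partial>(lborel :: real measure))"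
      by (rule nn_integral_cong_AE, use null[OF elim] in eventually_elim) auto
    then show ?case by simp
  qed
  finally have "emeasure ?M' ?Z = 0" by simp
  then show ?case
    using Z by (intro AE_I[of _ _ ?Z]) (auto simp: F_def)
qed

theorem AE_finite_image_fibre:
  fixes \<Phi> :: "'v \<Rightarrow> ('v, real) mpoly" and h :: "('v, real) mpoly"
  assumes fin: "finite V" and \<Phi>: "\<And>l. l \<in> V \<Longrightarrow> mp_vars (\<Phi> l) \<subseteq> V" and h: "mp_vars h \<subseteq> V"
  shows "AE c in (\<Pi>\<^sub>M l\<in>V. lborel). finite {mp_eval w h | w. \<forall>l\<in>V. mp_eval w (\<Phi> l) = c l}"
proof -
  obtain B C where C: "\<exists>j<B. \<exists>e\<in>V \<rightarrow>\<^sub>E {..<B}. C j e \<noteq> (0::real)"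
    and rel: "\<And>w. (\<Sum>j<B. (\<Sum>e\<in>V \<rightarrow>\<^sub>E {..<B}. C j e * (\<Prod>l\<in>V. mp_eval w (\<Phi> l) ^ e l)) *
      mp_eval w h ^ j) = 0"
    by (rule algebraic_dependence[of V \<Phi> h]) (assumption | rule fin \<Phi> h | rule that)+
  define r where "r j c = (\<Sum>e\<in>V \<rightarrow>\<^sub>E {..<B}. C j e * (\<Prod>l\<in>V. c l ^ e l))" for j c
  obtain j where j: "j < B" "\<exists>e\<in>V \<rightarrow>\<^sub>E {..<B}. C j e \<noteq> 0" using C by blast
  have "AE c in (\<Pi>\<^sub>M l\<in>V. lborel). r j c \<noteq> 0"
    unfolding r_def by (rule AE_polynomial_nonzero[OF fin j(2)])
  then show ?thesis
  proof eventually_elim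
    case (elim c)
    \<comment> \<open>This is the relation with each \<open>\<Phi> l\<close> replaced by the
      prescribed value \<open>c l\<close>. On the fibre it has \<open>mp_eval w h\<close> as a root,
      and one nonzero coefficient \<open>r j c\<close> suffices to bound the number of
      roots.\<close>
    define p where "p = (\<Sum>i<B. monom (r i c) i)"
    have "coeff p j = r j c" using j(1) by (simp add: p_def coeff_sum)
    then have "p \<noteq> 0" using elim by auto
    have "{mp_eval w h | w. \<forall>l\<in>V. mp_eval w (\<Phi> l) = c l} \<subseteq> {t. poly p t = 0}"
    proof safe
      fix w assume w: "\<forall>l\<in>V. mp_eval w (\<Phi> l) = c l"
      have "poly p (mp_eval w h) = (\<Sum>i<B. r i c * mp_eval w h ^ i)"
        by (simp add: p_def poly_sum poly_monom)
      also have "\<dots> = 0"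
        using rel[of w] w by (simp add: r_def)
      finally show "poly p (mp_eval w h) = 0" .
    qed
    then show ?case using poly_roots_finite[OF \<open>p \<noteq> 0\<close>] finite_subset by blast
  qed
qed

text \<open>Hiding the representing polynomial allows polynomiality of a map to be derived from
  closure rules alone.\<close>

definition polyfun :: "'v set \<Rightarrow> (('v \<Rightarrow> real) \<Rightarrow> real) \<Rightarrow> bool" where
  "polyfun V f \<longleftrightarrow> (\<exists>p. mp_vars p \<subseteq> V \<and> (\<forall>w. f w = mp_eval w p))"

lemma polyfun_const: "polyfun V (\<lambda>_. c)"
  unfolding polyfun_def by (intro exI[of _ "Poly_Mapping.single 0 c"]) (auto simp: mp_vars_def)

lemma polyfun_var: "v \<in> V \<Longrightarrow> polyfun V (\<lambda>w. w v)"
  unfolding polyfun_def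
  by (intro exI[of _ "Poly_Mapping.single (Poly_Mapping.single v 1) 1"])
    (auto simp: mp_vars_def mono_eval_def)

lemma polyfun_add: "polyfun V f \<Longrightarrow> polyfun V g \<Longrightarrow> polyfun V (\<lambda>w. f w + g w)"
  unfolding polyfun_def by (metis mp_eval_add mp_vars_add sup.bounded_iff subset_trans)

lemma polyfun_mult: "polyfun V f \<Longrightarrow> polyfun V g \<Longrightarrow> polyfun V (\<lambda>w. f w * g w)"
  unfolding polyfun_def by (metis mp_eval_mult mp_vars_mult sup.bounded_iff subset_trans)

lemma polyfun_diff: "polyfun V f \<Longrightarrow> polyfun V g \<Longrightarrow> polyfun V (\<lambda>w. f w - g w)"
  using polyfun_add[OF _ polyfun_mult[OF polyfun_const[of V "-1"]], of f g] by simp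

lemma polyfun_power: "polyfun V f \<Longrightarrow> polyfun V (\<lambda>w. f w ^ k)"
  by (induction k) (auto intro: polyfun_const polyfun_mult)

lemma polyfun_sum: "(\<And>i. i \<in> A \<Longrightarrow> polyfun V (f i)) \<Longrightarrow> polyfun V (\<lambda>w. \<Sum>i\<in>A. f i w)"
  by (induction A rule: infinite_finite_induct) (auto intro: polyfun_const polyfun_add)

lemma polyfun_prod: "(\<And>i. i \<in> A \<Longrightarrow> polyfun V (f i)) \<Longrightarrow> polyfun V (\<lambda>w. \<Prod>i\<in>A. f i w)"
  by (induction A rule: infinite_finite_induct) (auto intro: polyfun_const polyfun_mult)

lemma polyfun_mono_eval:
  "(\<And>v. v \<in> Poly_Mapping.keys \<mu> \<Longrightarrow> polyfun V (\<lambda>w. f w v)) \<Longrightarrow> polyfun V (\<lambda>w. mono_eval (f w) \<mu>)"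
  unfolding mono_eval_def by (intro polyfun_prod polyfun_power)

lemma AE_finite_image_fibre_polyfun:
  assumes "finite V" "\<And>l. l \<in> V \<Longrightarrow> polyfun V (\<lambda>w. \<Phi> w l)" "polyfun V h"
  shows "AE c in (\<Pi>\<^sub>M l\<in>V. lborel). finite {h w | w. \<forall>l\<in>V. \<Phi> w l = c l}"
proof -
  have "\<exists>p. \<forall>l\<in>V. mp_vars (p l) \<subseteq> V \<and> (\<forall>w. \<Phi> w l = mp_eval w (p l))"
    using assms(2) by (intro bchoice) (auto simp: polyfun_def)
  then obtain p where p: "\<And>l. l \<in> V \<Longrightarrow> mp_vars (p l) \<subseteq> V"
    "\<And>l w. l \<in> V \<Longrightarrow> \<Phi> w l = mp_eval w (p l)" by blast
  obtain q where q: "mp_vars q \<subseteq> V" "\<And>w. h w = mp_eval w q"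
    using assms(3) by (auto simp: polyfun_def)
  show ?thesis
    using AE_finite_image_fibre[of V p q] assms(1) p q by simp
qed

section \<open>Generic finiteness of the set of KKT points\<close>

lemma f_monomials_exponents:
  "f_monomials N n a i \<subseteq> exponents (Sigma {..<N} (\<lambda>j. {..<n j})) (\<Sum>j<N. a i j)"
proof
  fix \<mu> assume \<mu>: "\<mu> \<in> f_monomials N n a i"
  have "Poly_Mapping.lookup \<mu> (j, k) \<le> (\<Sum>j<N. a i j)" if "j < N" "k < n j" for j k
  proof -
    have "Poly_Mapping.lookup \<mu> (j, k) \<le> (\<Sum>k<n j. Poly_Mapping.lookup \<mu> (j, k))"
      using that by (intro member_le_sum) auto
    also have "\<dots> \<le> a i j" using \<mu> that by (simp add: f_monomials_def)
    also have "\<dots> \<le> (\<Sum>j<N. a i j)" using that by (intro member_le_sum) auto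
    finally show ?thesis .
  qed
  then show "\<mu> \<in> exponents (Sigma {..<N} (\<lambda>j. {..<n j})) (\<Sum>j<N. a i j)"
    using \<mu> by (auto simp: exponents_def f_monomials_def)
qed

lemma finite_f_monomials: "finite (f_monomials N n a i)"
  by (rule finite_subset[OF f_monomials_exponents exponents_card(1)]) auto

lemma g_monomials_exponents: "g_monomials n d i j \<subseteq> exponents {..<n i} (d i j)"
proof
  fix \<mu> assume \<mu>: "\<mu> \<in> g_monomials n d i j"
  have "Poly_Mapping.lookup \<mu> k \<le> d i j" if "k < n i" for k
  proof -
    have "Poly_Mapping.lookup \<mu> k \<le> (\<Sum>k<n i. Poly_Mapping.lookup \<mu> k)"
      using that by (intro member_le_sum) auto
    also have "\<dots> \<le> d i j" using \<mu> by (simp add: g_monomials_def)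
    finally show ?thesis .
  qed
  then show "\<mu> \<in> exponents {..<n i} (d i j)"
    using \<mu> by (auto simp: exponents_def g_monomials_def)
qed

lemma finite_g_monomials: "finite (g_monomials n d i j)"
  by (rule finite_subset[OF g_monomials_exponents exponents_card(1)]) auto

lemma finite_coeff_labels: "finite (coeff_labels N n m d a)"
proof -
  have "coeff_labels N n m d a =
      (\<Union>i<N. FCoeff i ` f_monomials N n a i) \<union> (\<Union>i<N. \<Union>j<m i. GCoeff i j ` g_monomials n d i j)"
    unfolding coeff_labels_def by blast
  then show ?thesis
    by (auto simp: finite_f_monomials finite_g_monomials)
qed

lemma lookup_sum_single:
  "finite A \<Longrightarrow> Poly_Mapping.lookup (\<Sum>\<mu>\<in>A. Poly_Mapping.single \<mu> (c \<mu>)) \<nu> = (if \<nu> \<in> A then c \<nu> else 0)"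
  by (simp add: lookup_sum lookup_single when_def)

lemma keys_sum_single:
  "finite A \<Longrightarrow> Poly_Mapping.keys (\<Sum>\<mu>\<in>A. Poly_Mapping.single \<mu> (c \<mu>)) \<subseteq> A"
  by (auto simp: in_keys_iff lookup_sum_single split: if_splits)

lemma mp_eval_sum_single:
  "finite A \<Longrightarrow> mp_eval x (\<Sum>\<mu>\<in>A. Poly_Mapping.single \<mu> (c \<mu>)) = (\<Sum>\<mu>\<in>A. c \<mu> * mono_eval x \<mu>)"
  by (simp add: mp_eval_sum)

lemma mp_eval_deriv_sum_single:
  assumes "finite A"
  shows "mp_eval x (mp_deriv k (\<Sum>\<mu>\<in>A. Poly_Mapping.single \<mu> (c \<mu>))) =
    (\<Sum>\<mu>\<in>A. of_nat (Poly_Mapping.lookup \<mu> k) * c \<mu> * mono_eval x (\<mu> - Poly_Mapping.single k 1))"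
  by (subst mp_eval_deriv_superset[OF assms keys_sum_single[OF assms]])
    (simp add: lookup_sum_single[OF assms])

text \<open>Here positivity of the degree of \<open>f_i\<close> in its own block enters: the linear
  coefficients to be solved for are among the generic ones.\<close>

lemma single_in_f_monomials:
  assumes "i < N" "k < n i" "a i i > 0"
  shows "Poly_Mapping.single (i, k) 1 \<in> f_monomials N n a i"
proof -
  have "(\<Sum>k'<n j. Poly_Mapping.lookup (Poly_Mapping.single (i, k) 1) (j, k')) \<le> a i j" for j
    using assms by (cases "j = i") (auto simp: lookup_single when_def)
  then show ?thesis using assms by (auto simp: f_monomials_def)
qed

lemma zero_in_g_monomials: "0 \<in> g_monomials n d i j"
  by (simp add: g_monomials_def)

text \<open>
  Once the active sets \<open>J i\<close> are fixed, the KKT equations can be solved for the coefficients of the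
  linear monomials of \<open>f\<^sub>i\<close> in \<open>x\<^sub>i\<close> and for the constant coefficients of the active \<open>g\<^sub>i\<^sub>,\<^sub>j\<close>.
  There are exactly as many of these coefficients as unknowns, so their labels are reused
  for the unknowns: in \<open>w\<close>, \<open>lin_label i k\<close> holds the coordinate \<open>x\<^sub>i\<^sub>,\<^sub>k\<close> and \<open>GCoeff i j 0\<close> holds
  the multiplier \<open>\<lambda>\<^sub>i\<^sub>,\<^sub>j\<close>, while all other entries are coefficients.
\<close>

definition lin_label :: "nat \<Rightarrow> nat \<Rightarrow> coeff_label" where
  "lin_label i k = FCoeff i (Poly_Mapping.single (i, k) 1)"

context
  fixes N :: nat and n m :: "nat \<Rightarrow> nat" and d a :: "nat \<Rightarrow> nat \<Rightarrow> nat"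
begin

text \<open>The derivative of \<open>f_i\<close> in \<open>x_{i,k}\<close> without its constant term
  from the monomial \<open>x_{i,k}\<close>. Entries of \<open>w\<close> at other linear monomials of
  block \<open>i\<close> are coordinates, not coefficients, but they are multiplied by the exponent
  0.\<close>

definition obj_grad :: "(coeff_label \<Rightarrow> real) \<Rightarrow> nat \<Rightarrow> nat \<Rightarrow> real" where
  "obj_grad w i k = (\<Sum>\<nu>\<in>f_monomials N n a i - {Poly_Mapping.single (i, k) 1}.
     real (Poly_Mapping.lookup \<nu> (i, k)) * w (FCoeff i \<nu>) *
     mono_eval (\<lambda>(j, k'). w (lin_label j k')) (\<nu> - Poly_Mapping.single (i, k) 1))"

text \<open>This is the true derivative of \<open>g_{i,j}\<close> although \<open>w\<close> may hold
  a multiplier at \<open>GCoeff i j 0\<close>: the constant monomial has derivative 0.\<close>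

definition constr_grad :: "(coeff_label \<Rightarrow> real) \<Rightarrow> nat \<Rightarrow> nat \<Rightarrow> nat \<Rightarrow> real" where
  "constr_grad w i j k = (\<Sum>\<nu>\<in>g_monomials n d i j.
     real (Poly_Mapping.lookup \<nu> k) * w (GCoeff i j \<nu>) *
     mono_eval (\<lambda>k'. w (lin_label i k')) (\<nu> - Poly_Mapping.single k 1))"

text \<open>The polynomial map whose fibres contain the KKT points: solved coefficients are
  expressed by the unknowns, all others are passed through. The term
  \<open>snd (the_elem ...)\<close> reads the coordinate \<open>k\<close> off a linear
  monomial.\<close>

fun solved_coeffs :: "(nat \<Rightarrow> nat set) \<Rightarrow> (coeff_label \<Rightarrow> real) \<Rightarrow> coeff_label \<Rightarrow> real" where
  "solved_coeffs J w (FCoeff i \<mu>) =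
     (if \<exists>k<n i. \<mu> = Poly_Mapping.single (i, k) 1 then
        let k = snd (the_elem (Poly_Mapping.keys \<mu>)) in
          (\<Sum>j\<in>J i. w (GCoeff i j 0) * constr_grad w i j k) - obj_grad w i k
      else w (FCoeff i \<mu>))"
| "solved_coeffs J w (GCoeff i j \<mu>) =
     (if j \<in> J i \<and> \<mu> = 0 then
        0 - (\<Sum>\<nu>\<in>g_monomials n d i j - {0}.
          w (GCoeff i j \<nu>) * mono_eval (\<lambda>k. w (lin_label i k)) \<nu>)
      else w (GCoeff i j \<mu>))"

lemma polyfun_solved_coeffs:
  assumes a: "\<And>i. i < N \<Longrightarrow> a i i > 0"
    and J: "\<And>i. i < N \<Longrightarrow> J i \<subseteq> {..<m i}"
    and l: "l \<in> coeff_labels N n m d a"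
  shows "polyfun (coeff_labels N n m d a) (\<lambda>w. solved_coeffs J w l)"
proof -
  let ?L = "coeff_labels N n m d a"
  have lin: "polyfun ?L (\<lambda>w. w (lin_label i k))" if "i < N" "k < n i" for i k
    using that a single_in_f_monomials[of i N k n a]
    by (intro polyfun_var) (auto simp: coeff_labels_def lin_label_def)
  have f: "polyfun ?L (\<lambda>w. w (FCoeff i \<nu>))" if "i < N" "\<nu> \<in> f_monomials N n a i" for i \<nu>
    using that by (intro polyfun_var) (auto simp: coeff_labels_def)
  have g: "polyfun ?L (\<lambda>w. w (GCoeff i j \<nu>))" if "i < N" "j < m i" "\<nu> \<in> g_monomials n d i j" for i j \<nu>
    using that by (intro polyfun_var) (auto simp: coeff_labels_def)
  have mf: "polyfun ?L (\<lambda>w. mono_eval (\<lambda>(j, k'). w (lin_label j k')) (\<nu> - \<kappa>))"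
    if "\<nu> \<in> f_monomials N n a i" for i \<nu> \<kappa>
  proof (rule polyfun_mono_eval)
    fix v assume "v \<in> Poly_Mapping.keys (\<nu> - \<kappa>)"
    then have "v \<in> Sigma {..<N} (\<lambda>j. {..<n j})"
      using that keys_diff_subset[of \<nu> \<kappa>] by (auto simp: f_monomials_def)
    then show "polyfun ?L (\<lambda>w. case v of (j, k') \<Rightarrow> w (lin_label j k'))"
      by (auto intro: lin)
  qed
  have mg: "polyfun ?L (\<lambda>w. mono_eval (\<lambda>k. w (lin_label i k)) (\<nu> - \<kappa>))"
    if "i < N" "\<nu> \<in> g_monomials n d i j" for i j \<nu> \<kappa>
  proof (rule polyfun_mono_eval)
    fix k assume "k \<in> Poly_Mapping.keys (\<nu> - \<kappa>)"
    then have "k < n i"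
      using that keys_diff_subset[of \<nu> \<kappa>] by (auto simp: g_monomials_def)
    then show "polyfun ?L (\<lambda>w. w (lin_label i k))"
      using that by (auto intro: lin)
  qed
  show ?thesis
  proof (cases l)
    case (FCoeff i \<mu>)
    then have i: "i < N" "\<mu> \<in> f_monomials N n a i" using l by (auto simp: coeff_labels_def)
    have mul: "j < m i" if "j \<in> J i" for j using J[OF i(1)] that by auto
    show ?thesis
    proof (cases "\<exists>k<n i. \<mu> = Poly_Mapping.single (i, k) 1")
      case True
      then obtain k where k: "k < n i" "\<mu> = Poly_Mapping.single (i, k) 1" by blast
      have eq: "solved_coeffs J w l = (\<Sum>j\<in>J i. w (GCoeff i j 0) * constr_grad w i j k) - obj_grad w i k"
        for w
        using k by (auto simp: FCoeff)
      have "polyfun ?L (\<lambda>w. obj_grad w i k)"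
        unfolding obj_grad_def using i
        by (intro polyfun_sum polyfun_mult polyfun_const f mf) auto
      moreover have "polyfun ?L (\<lambda>w. constr_grad w i j k)" if "j \<in> J i" for j
        unfolding constr_grad_def using i mul[OF that]
        by (intro polyfun_sum polyfun_mult polyfun_const g mg) auto
      ultimately show ?thesis
        unfolding eq using i mul
        by (intro polyfun_diff polyfun_sum polyfun_mult g zero_in_g_monomials) auto
    next
      case False
      then have eq: "solved_coeffs J w l = w (FCoeff i \<mu>)" for w by (auto simp: FCoeff)
      show ?thesis unfolding eq using f i by blast
    qed
  next
    case (GCoeff i j \<mu>)
    then have i: "i < N" "j < m i" "\<mu> \<in> g_monomials n d i j" using l by (auto simp: coeff_labels_def)
    \<comment> \<open>The shift by 0 brings the monomials into the form covered by
      \<open>mg\<close>.\<close>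
    have "polyfun ?L (\<lambda>w. 0 - (\<Sum>\<nu>\<in>g_monomials n d i j - {0}.
        w (GCoeff i j \<nu>) * mono_eval (\<lambda>k. w (lin_label i k)) (\<nu> - 0)))"
      using i by (intro polyfun_diff polyfun_const polyfun_sum polyfun_mult g mg) auto
    moreover have "polyfun ?L (\<lambda>w. w (GCoeff i j \<mu>))" using g[OF i] .
    ultimately show ?thesis
      unfolding GCoeff by (cases "j \<in> J i \<and> \<mu> = 0") (auto cong: if_cong)
  qed
qed

text \<open>The active constraints at \<open>x\<close> give \<open>J\<close>, and \<open>x\<close>
  with its multipliers fills the reused slots of \<open>w\<close>. Complementarity removes the
  multipliers of inactive constraints, so stationarity and activity are exactly the solved
  equations.\<close>

lemma kkt_point_solved_coeffs:
  assumes EI: "\<And>i. i < N \<Longrightarrow> E i \<union> I i = {..<m i}"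
    and a: "\<And>i. i < N \<Longrightarrow> a i i > 0"
    and kkt: "kkt_point (nep_of_coeffs N n m E I d a c) H x"
  obtains J w where "J \<in> {..<N} \<rightarrow>\<^sub>E Pow (\<Union>i<N. {..<m i})" "\<And>i. i < N \<Longrightarrow> J i \<subseteq> {..<m i}"
    "\<And>l. l \<in> coeff_labels N n m d a \<Longrightarrow> solved_coeffs J w l = c l"
    "\<And>i k. i < N \<Longrightarrow> k < n i \<Longrightarrow> w (lin_label i k) = x i $ k"
proof -
  define P where "P = nep_of_coeffs N n m E I d a c"
  have P: "players P = N" "sdim P = n" "ncons P = m" "eqs P = E" "ineqs P = I"
    "\<And>i. objective P i = (\<Sum>\<mu>\<in>f_monomials N n a i. Poly_Mapping.single \<mu> (c (FCoeff i \<mu>)))"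
    "\<And>i j. constr P i j = (\<Sum>\<mu>\<in>g_monomials n d i j. Poly_Mapping.single \<mu> (c (GCoeff i j \<mu>)))"
    by (simp_all add: P_def nep_of_coeffs_def)
  define lam where "lam i j = multipliers P H i x $ j" for i j
  \<comment> \<open>All constraints vanishing at \<open>x\<close> are active, including every
    equality. The restriction to \<open>{..<N}\<close> leaves only finitely many possible
    \<open>J\<close>.\<close>
  define J where "J = (\<lambda>i\<in>{..<N}. {j\<in>{..<m i}. block_eval (x i) (constr P i j) = 0})"
  define w where "w l = (case l of
      FCoeff i \<mu> \<Rightarrow> if \<exists>k<n i. \<mu> = Poly_Mapping.single (i, k) 1
        then x i $ snd (the_elem (Poly_Mapping.keys \<mu>)) else c l
    | GCoeff i j \<mu> \<Rightarrow> if j \<in> J i \<and> \<mu> = 0 then lam i j else c l)" for l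
  note kkt = kkt[folded P_def]
  have wx: "w (lin_label i k) = x i $ k" if "k < n i" for i k
    using that by (auto simp: w_def lin_label_def)
  have wg: "w (GCoeff i j \<nu>) = c (GCoeff i j \<nu>)" if "\<nu> \<noteq> 0" for i j \<nu>
    using that by (simp add: w_def)
  have mg: "mono_eval (\<lambda>k. w (lin_label i k)) (\<nu> - \<kappa>) = mono_eval (\<lambda>k. x i $ k) (\<nu> - \<kappa>)"
    if "\<nu> \<in> g_monomials n d i j" for i j \<nu> \<kappa>
    using that keys_diff_subset[of \<nu> \<kappa>]
    by (intro mono_eval_cong wx) (auto simp: g_monomials_def)
  have mf: "mono_eval (\<lambda>(j, k). w (lin_label j k)) (\<nu> - \<kappa>) = mono_eval (\<lambda>(j, k). x j $ k) (\<nu> - \<kappa>)"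
    if "\<nu> \<in> f_monomials N n a i" for i \<nu> \<kappa>
    using that keys_diff_subset[of \<nu> \<kappa>]
    by (intro mono_eval_cong) (auto simp: f_monomials_def wx)
  have "solved_coeffs J w l = c l" if l: "l \<in> coeff_labels N n m d a" for l
  proof (cases l)
    case (FCoeff i \<mu>)
    then have i: "i < N" using l by (auto simp: coeff_labels_def)
    show ?thesis
    proof (cases "\<exists>k<n i. \<mu> = Poly_Mapping.single (i, k) 1")
      case False
      then show ?thesis by (auto simp: FCoeff w_def)
    next
      case True
      then obtain k where k: "k < n i" "\<mu> = Poly_Mapping.single (i, k) 1" by blast
      have cg: "constr_grad w i j k = block_eval (x i) (mp_deriv k (constr P i j))" for j
        unfolding constr_grad_def P mp_eval_deriv_sum_single[OF finite_g_monomials]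
      proof (rule sum.cong[OF refl])
        fix \<nu> assume "\<nu> \<in> g_monomials n d i j"
        then show "real (Poly_Mapping.lookup \<nu> k) * w (GCoeff i j \<nu>) *
            mono_eval (\<lambda>k'. w (lin_label i k')) (\<nu> - Poly_Mapping.single k 1) =
          real (Poly_Mapping.lookup \<nu> k) * c (GCoeff i j \<nu>) *
            mono_eval (\<lambda>k. x i $ k) (\<nu> - Poly_Mapping.single k 1)"
          using mg wg by (cases "\<nu> = 0") auto
      qed
      have og: "own_gradient P i x $ k = c l + obj_grad w i k"
      proof -
        have in_f: "\<mu> \<in> f_monomials N n a i"
          using single_in_f_monomials[of i N k n a] a i k by auto
        have "obj_grad w i k = (\<Sum>\<nu>\<in>f_monomials N n a i - {\<mu>}.
            real (Poly_Mapping.lookup \<nu> (i, k)) * c (FCoeff i \<nu>) *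
            mono_eval (\<lambda>(j, k). x j $ k) (\<nu> - Poly_Mapping.single (i, k) 1))"
          unfolding obj_grad_def k(2)[symmetric]
        proof (rule sum.cong[OF refl])
          fix \<nu> assume \<nu>: "\<nu> \<in> f_monomials N n a i - {\<mu>}"
          show "real (Poly_Mapping.lookup \<nu> (i, k)) * w (FCoeff i \<nu>) *
              mono_eval (\<lambda>(j, k'). w (lin_label j k')) (\<nu> - \<mu>) =
            real (Poly_Mapping.lookup \<nu> (i, k)) * c (FCoeff i \<nu>) *
              mono_eval (\<lambda>(j, k). x j $ k) (\<nu> - \<mu>)"
          proof (cases "\<exists>k'<n i. \<nu> = Poly_Mapping.single (i, k') 1")
            case True
            \<comment> \<open>A different linear monomial of block \<open>i\<close> does not contain
              \<open>x_{i,k}\<close>, so its reused slot does not contribute.\<close>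
            then have "Poly_Mapping.lookup \<nu> (i, k) = 0"
              using \<nu> k by (auto simp: lookup_single when_def)
            then show ?thesis by simp
          next
            case False
            then have "w (FCoeff i \<nu>) = c (FCoeff i \<nu>)" by (auto simp: w_def)
            then show ?thesis using mf[of \<nu> i \<mu>] \<nu> by simp
          qed
        qed
        moreover have "own_gradient P i x $ k =
            (\<Sum>\<nu>\<in>f_monomials N n a i. real (Poly_Mapping.lookup \<nu> (i, k)) * c (FCoeff i \<nu>) *
            mono_eval (\<lambda>(j, k). x j $ k) (\<nu> - Poly_Mapping.single (i, k) 1))"
          using k by (simp add: own_gradient_def P mp_eval_deriv_sum_single[OF finite_f_monomials])
        ultimately show ?thesis
          using in_f by (simp add: sum.remove[OF finite_f_monomials in_f] k FCoeff)
      qed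
      have "(\<Sum>j<m i. lam i j * block_eval (x i) (mp_deriv k (constr P i j))) =
          (\<Sum>j\<in>J i. lam i j * block_eval (x i) (mp_deriv k (constr P i j)))"
      proof (rule sum.mono_neutral_right)
        show "\<forall>j\<in>{..<m i} - J i. lam i j * block_eval (x i) (mp_deriv k (constr P i j)) = 0"
        proof
          fix j assume j: "j \<in> {..<m i} - J i"
          \<comment> \<open>Equality constraints vanish at a KKT point, so an inactive label belongs
            to \<open>I i\<close>, where complementarity applies.\<close>
          then have g: "block_eval (x i) (constr P i j) \<noteq> 0" using i by (auto simp: J_def)
          then have "j \<in> I i" using EI[OF i] j kkt i by (auto simp: kkt_point_def P(1-5))
          then have "lam i j * block_eval (x i) (constr P i j) = 0"
            using kkt i by (auto simp: kkt_point_def P(1-5) lam_def)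
          then show "lam i j * block_eval (x i) (mp_deriv k (constr P i j)) = 0" using g by simp
        qed
      qed (use i in \<open>auto simp: J_def\<close>)
      moreover have "own_gradient P i x $ k =
          (\<Sum>j<m i. lam i j * block_eval (x i) (mp_deriv k (constr P i j)))"
        using kkt i k by (auto simp: kkt_point_def P(1-5) lam_def)
      moreover have "w (GCoeff i j 0) = lam i j" if "j \<in> J i" for j
        using that by (simp add: w_def)
      ultimately have "(\<Sum>j\<in>J i. w (GCoeff i j 0) * constr_grad w i j k) - obj_grad w i k = c l"
        using og by (simp add: cg)
      then show ?thesis using k by (auto simp: FCoeff)
    qed
  next
    case (GCoeff i j \<mu>)
    then have i: "i < N" using l by (auto simp: coeff_labels_def)
    show ?thesis
    proof (cases "j \<in> J i \<and> \<mu> = 0")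
      case False
      then show ?thesis by (auto simp: GCoeff w_def)
    next
      case True
      have "0 = block_eval (x i) (constr P i j)" using True i by (simp add: J_def)
      also have "\<dots> = c (GCoeff i j 0) + (\<Sum>\<nu>\<in>g_monomials n d i j - {0}.
          c (GCoeff i j \<nu>) * mono_eval (\<lambda>k. x i $ k) \<nu>)"
        unfolding P mp_eval_sum_single[OF finite_g_monomials]
        by (simp add: sum.remove[OF finite_g_monomials zero_in_g_monomials])
      also have "(\<Sum>\<nu>\<in>g_monomials n d i j - {0}. c (GCoeff i j \<nu>) * mono_eval (\<lambda>k. x i $ k) \<nu>) =
          (\<Sum>\<nu>\<in>g_monomials n d i j - {0}. w (GCoeff i j \<nu>) * mono_eval (\<lambda>k. w (lin_label i k)) \<nu>)"
        using mg[of _ i j 0] by (intro sum.cong) (auto simp: wg)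
      finally show ?thesis using True by (simp add: GCoeff)
    qed
  qed
  moreover have "J \<in> {..<N} \<rightarrow>\<^sub>E Pow (\<Union>i<N. {..<m i})" "\<And>i. i < N \<Longrightarrow> J i \<subseteq> {..<m i}"
    by (auto simp: J_def)
  ultimately show ?thesis using that wx by blast
qed

text \<open>The exceptional null set is the same for all \<open>H\<close>, because multiplier values
  enter the fibres as free unknowns. One null set for each active pattern and each coordinate leaves
  a finite union.\<close>

theorem AE_finite_kkt_points:
  assumes EI: "\<And>i. i < N \<Longrightarrow> E i \<union> I i = {..<m i}"
    and a: "\<And>i. i < N \<Longrightarrow> a i i > 0"
  shows "AE c in coeff_measure N n m d a.
    \<forall>H. finite {x. kkt_point (nep_of_coeffs N n m E I d a c) H x}"
proof -
  let ?L = "coeff_labels N n m d a"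
  define \<J> where "\<J> = {J \<in> {..<N} \<rightarrow>\<^sub>E Pow (\<Union>i<N. {..<m i}). \<forall>i<N. J i \<subseteq> {..<m i}}"
  define Z where "Z c J i k = {w (lin_label i k) | w. \<forall>l\<in>?L. solved_coeffs J w l = c l}" for c J i k
  have fin\<J>: "finite \<J>"
    unfolding \<J>_def by (rule finite_subset[of _ "{..<N} \<rightarrow>\<^sub>E Pow (\<Union>i<N. {..<m i})"])
      (auto intro: finite_PiE)
  have "AE c in coeff_measure N n m d a. finite (Z c J i k)"
    if "J \<in> \<J>" "i < N" "k < n i" for J i k
    unfolding coeff_measure_def Z_def
  proof (rule AE_finite_image_fibre_polyfun)
    show "polyfun ?L (\<lambda>w. w (lin_label i k))"
      using that a single_in_f_monomials[of i N k n a]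
      by (intro polyfun_var) (auto simp: coeff_labels_def lin_label_def)
    show "polyfun ?L (\<lambda>w. solved_coeffs J w l)" if "l \<in> ?L" for l
      using polyfun_solved_coeffs[OF a _ that, of J] \<open>J \<in> \<J>\<close> by (auto simp: \<J>_def)
  qed (rule finite_coeff_labels)
  then have "AE c in coeff_measure N n m d a.
      \<forall>(J, i, k)\<in>\<J> \<times> Sigma {..<N} (\<lambda>i. {..<n i}). finite (Z c J i k)"
    using fin\<J> by (subst AE_ball_countable) (auto intro: countable_finite)
  then show ?thesis
  proof eventually_elim
    case (elim c)
    \<comment> \<open>Finiteness of all coordinate values yields finitely many blocks, and hence
      finitely many profiles.\<close>
    let ?V = "\<lambda>i. {v \<in> carrier_vec (n i). \<forall>k<n i. v $ k \<in> (\<Union>J\<in>\<J>. Z c J i k)}"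
    have fin: "finite (?V i)" if "i < N" for i
    proof (rule finite_subset)
      show "?V i \<subseteq> vec (n i) ` (\<Pi>\<^sub>E k\<in>{..<n i}. \<Union>J\<in>\<J>. Z c J i k)"
      proof
        fix v assume v: "v \<in> ?V i"
        then have "v = vec (n i) (\<lambda>k\<in>{..<n i}. v $ k)" by (intro eq_vecI) auto
        moreover have "(\<lambda>k\<in>{..<n i}. v $ k) \<in> (\<Pi>\<^sub>E k\<in>{..<n i}. \<Union>J\<in>\<J>. Z c J i k)"
          using v by auto
        ultimately show "v \<in> vec (n i) ` (\<Pi>\<^sub>E k\<in>{..<n i}. \<Union>J\<in>\<J>. Z c J i k)" by blast
      qed
      show "finite (vec (n i) ` (\<Pi>\<^sub>E k\<in>{..<n i}. \<Union>J\<in>\<J>. Z c J i k))"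
        using elim that fin\<J> by (intro finite_imageI finite_PiE finite_UN_I) auto
    qed
    show ?case
    proof
      fix H
      have "{x. kkt_point (nep_of_coeffs N n m E I d a c) H x} \<subseteq> (\<Pi>\<^sub>E i\<in>{..<N}. ?V i)"
      proof
        fix x assume "x \<in> {x. kkt_point (nep_of_coeffs N n m E I d a c) H x}"
        then have kkt: "kkt_point (nep_of_coeffs N n m E I d a c) H x" by simp
        obtain J w where J: "J \<in> {..<N} \<rightarrow>\<^sub>E Pow (\<Union>i<N. {..<m i})" "\<And>i. i < N \<Longrightarrow> J i \<subseteq> {..<m i}"
          and w: "\<And>l. l \<in> ?L \<Longrightarrow> solved_coeffs J w l = c l"
            "\<And>i k. i < N \<Longrightarrow> k < n i \<Longrightarrow> w (lin_label i k) = x i $ k"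
          by (rule kkt_point_solved_coeffs[of E I c H x]) (assumption | rule EI a kkt | rule that)+
        have "J \<in> \<J>" using J by (auto simp: \<J>_def)
        moreover have "x i $ k \<in> Z c J i k" if "i < N" "k < n i" for i k
          unfolding Z_def mem_Collect_eq using w that by (intro exI[of _ w]) auto
        moreover have "x \<in> (\<Pi>\<^sub>E i\<in>{..<N}. carrier_vec (n i))"
          using kkt by (simp add: kkt_point_def profiles_def nep_of_coeffs_def)
        ultimately show "x \<in> (\<Pi>\<^sub>E i\<in>{..<N}. ?V i)"
          unfolding PiE_iff by blast
      qed
      then show "finite {x. kkt_point (nep_of_coeffs N n m E I d a c) H x}"
        by (rule finite_subset) (intro finite_PiE fin; simp)
    qed
  qed
qed

end

section \<open>Nash equilibria are KKT points\<close>

text \<open>Squaring removes the kink at 0, which makes the penalty for a violated inequality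
  differentiable.\<close>

lemma min_zero_power2_has_derivative:
  "((\<lambda>u::real. (min u 0)\<^sup>2) has_field_derivative 2 * min u 0) (at u)"
proof -
  consider "u < 0" | "u > 0" | "u = 0" by linarith
  then show ?thesis
  proof cases
    case 1
    have "((\<lambda>u::real. u\<^sup>2) has_field_derivative 2 * min u 0) (at u)"
      using 1 by (auto intro!: derivative_eq_intros)
    then show ?thesis
      by (rule has_field_derivative_transform_within_open[where S = "{..<0}"]) (use 1 in auto)
  next
    case 2
    have "((\<lambda>u::real. 0) has_field_derivative 2 * min u 0) (at u)"
      using 2 by (auto intro!: derivative_eq_intros)
    then show ?thesis
      by (rule has_field_derivative_transform_within_open[where S = "{0<..}"]) (use 2 in auto)
  next
    case 3
    have "(\<lambda>h::real. min h 0) \<midarrow>0\<rightarrow> min 0 0"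
      by (intro tendsto_intros)
    \<comment> \<open>At 0 the difference quotient is \<open>min h 0\<close> itself.\<close>
    then have "(\<lambda>h::real. (min h 0)\<^sup>2 / h) \<midarrow>0\<rightarrow> min 0 0"
      by (rule Lim_transform_eventually)
        (auto simp: eventually_at_filter min_def power2_eq_square)
    then show ?thesis
      using 3 by (simp add: DERIV_def)
  qed
qed

text \<open>
  The minimizers \<open>z\<close> of \<open>f + \<bar>\<cdot> - v\<bar>\<^sup>2 + t * \<Sum>r\<^sub>j\<^sup>2\<close> on a box around \<open>v\<close> tend to \<open>v\<close>, and
  \<open>-2 t r\<^sub>j(z)\<close> are approximate multipliers at \<open>z\<close>. The left inverse recovers them from the gradient
  of \<open>f\<close> at \<open>z\<close>, up to terms \<open>t r\<^sub>j(z)\<^sup>2\<close> that vanish in the limit. Hence they converge, and the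
  limit is the multiplier expression at \<open>v\<close>.
\<close>

lemma minimizer_multipliers:
  fixes f :: "(nat \<Rightarrow> real) \<Rightarrow> real" and g :: "nat \<Rightarrow> (nat \<Rightarrow> real) \<Rightarrow> real"
    and f' :: "nat \<Rightarrow> (nat \<Rightarrow> real) \<Rightarrow> real" and g' h h' :: "nat \<Rightarrow> nat \<Rightarrow> (nat \<Rightarrow> real) \<Rightarrow> real"
  assumes cont_f: "continuous_on UNIV f" and cont_g: "\<And>j. continuous_on UNIV (g j)"
    and cont_f': "\<And>k. continuous_on UNIV (f' k)" and cont_g': "\<And>j k. continuous_on UNIV (g' j k)"
    and cont_h: "\<And>j k. continuous_on UNIV (h j k)" and cont_h': "\<And>j k. continuous_on UNIV (h' j k)"
    and der_f: "\<And>k x. ((\<lambda>t. f (x(k := t))) has_field_derivative f' k x) (at (x k))"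
    and der_g: "\<And>j k x. ((\<lambda>t. g j (x(k := t))) has_field_derivative g' j k x) (at (x k))"
    and left_inv: "\<And>x j j'. j < m \<Longrightarrow> j' < m \<Longrightarrow>
      (\<Sum>k<n. h j k x * g' j' k x) + h' j j' x * g j' x = (if j = j' then 1 else 0)"
    and EI: "E \<union> I = {..<m}" "E \<inter> I = {}"
    and v: "\<And>j. j \<in> E \<Longrightarrow> g j v = 0" "\<And>j. j \<in> I \<Longrightarrow> g j v \<ge> 0"
    and min: "\<And>x. \<lbrakk>\<And>k. k \<ge> n \<Longrightarrow> x k = v k; \<And>j. j \<in> E \<Longrightarrow> g j x = 0; \<And>j. j \<in> I \<Longrightarrow> g j x \<ge> 0\<rbrakk>
      \<Longrightarrow> f v \<le> f x"
  defines "lam \<equiv> \<lambda>j. \<Sum>k<n. h j k v * f' k v"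
  shows "\<And>k. k < n \<Longrightarrow> f' k v - (\<Sum>j<m. lam j * g' j k v) = 0"
    and "\<And>j. j \<in> I \<Longrightarrow> lam j \<ge> 0" and "\<And>j. j \<in> I \<Longrightarrow> lam j * g j v = 0"
proof -
  \<comment> \<open>Points have infinitely many coordinates; those from \<open>n\<close> on are
    frozen at \<open>v\<close>, and the box is compact in the product topology.\<close>
  define S where "S = (\<Pi>\<^sub>E k\<in>UNIV. if k < n then {v k - 1..v k + 1} else {v k})"
  define r where "r j x = (if j \<in> E then g j x else min (g j x) 0)" for j x
  \<comment> \<open>This proximity term singles out \<open>v\<close> among possibly many
    minimizers.\<close>
  define D where "D x = (\<Sum>k<n. (x k - v k)\<^sup>2)" for x
  define pen where "pen x = (\<Sum>j<m. (r j x)\<^sup>2)" for x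
  define F where "F t x = f x + D x + t * pen x" for t x
  have cont_r: "continuous_on UNIV (r j)" for j
    unfolding r_def by (cases "j \<in> E") (auto intro!: continuous_intros cont_g)
  have cont_D: "continuous_on UNIV D"
    unfolding D_def by (intro continuous_intros continuous_on_product_coordinates)
  have cont_pen: "continuous_on UNIV pen"
    unfolding pen_def by (intro continuous_intros cont_r)
  have pen_nonneg: "0 \<le> pen x" for x
    unfolding pen_def by (intro sum_nonneg) auto
  have D_nonneg: "0 \<le> D x" for x
    unfolding D_def by (intro sum_nonneg) auto
  have rv: "r j v = 0" if "j < m" for j
    using v that EI by (auto simp: r_def)
  have S_iff: "x \<in> S \<longleftrightarrow> (\<forall>k. (k < n \<longrightarrow> \<bar>x k - v k\<bar> \<le> 1) \<and> (\<not> k < n \<longrightarrow> x k = v k))" for x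
  proof -
    have "x k \<in> (if k < n then {v k - 1..v k + 1} else {v k}) \<longleftrightarrow>
        (k < n \<longrightarrow> \<bar>x k - v k\<bar> \<le> 1) \<and> (\<not> k < n \<longrightarrow> x k = v k)" for k
      by (auto simp: abs_le_iff)
    then show ?thesis by (simp add: S_def PiE_iff)
  qed
  have "compact S"
    using compactin_PiE[of "\<lambda>_::nat. euclidean :: real topology" UNIV]
    by (auto simp: S_def euclidean_product_topology)
  have "v \<in> S" by (auto simp: S_def)
  have "\<exists>y\<in>S. \<forall>x\<in>S. F t y \<le> F t x" for t
  proof (rule continuous_attains_inf[OF \<open>compact S\<close>])
    have "continuous_on UNIV (F t)"
      unfolding F_def
      by (intro continuous_on_add continuous_on_mult_left cont_f cont_D cont_pen)
    then show "continuous_on S (F t)" by (rule continuous_on_subset) simp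
  qed (use \<open>v \<in> S\<close> in auto)
  then obtain y where y: "\<And>t. y t \<in> S" "\<And>t x. x \<in> S \<Longrightarrow> F t (y t) \<le> F t x" by metis
  have "seq_compact S" using \<open>compact S\<close> by (rule compact_imp_seq_compact)
  then obtain l s where l: "l \<in> S" and s: "strict_mono s" and lim: "((\<lambda>t. y (real t)) \<circ> s) \<longlonglongrightarrow> l"
    by (rule seq_compactE[where f = "\<lambda>t. y (real t)"]) (use y in auto)
  define z where "z = (\<lambda>t. y (real (s t)))"
  have zS: "z t \<in> S" for t using y(1) by (simp add: z_def)
  have zl: "z \<longlonglongrightarrow> l" using lim by (simp add: z_def comp_def)
  have tends: "(\<lambda>t. \<phi> (z t)) \<longlonglongrightarrow> \<phi> l" if "continuous_on UNIV \<phi>" for \<phi> :: "(nat \<Rightarrow> real) \<Rightarrow> real"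
    using continuous_on_tendsto_compose[OF that zl] by simp
  \<comment> \<open>Comparison with \<open>v\<close>, where both the penalty and \<open>D\<close>
    vanish.\<close>
  have bound: "f (z t) + D (z t) + real (s t) * pen (z t) \<le> f v" for t
    using y(2)[OF \<open>v \<in> S\<close>, of "real (s t)"] rv by (simp add: F_def z_def pen_def D_def)
  \<comment> \<open>The weighted penalty stays bounded while the weights tend to infinity, so the
    limit is feasible.\<close>
  have "pen l \<le> 0"
  proof (rule LIMSEQ_le[OF tends[OF cont_pen]])
    have "filterlim (\<lambda>t. real (s t)) at_top sequentially"
      using filterlim_compose[OF filterlim_real_sequentially filterlim_subseq[OF s]] .
    then have "(\<lambda>t. inverse (real (s t))) \<longlonglongrightarrow> 0"
      by (rule tendsto_inverse_0_at_top)
    moreover have "(\<lambda>t. f v - f (z t) - D (z t)) \<longlonglongrightarrow> f v - f l - D l"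
      by (intro tendsto_intros tends[OF cont_f] tends[OF cont_D])
    ultimately show "(\<lambda>t. (f v - f (z t) - D (z t)) * inverse (real (s t))) \<longlonglongrightarrow> 0"
      by (auto intro: tendsto_eq_intros)
    show "\<exists>t0. \<forall>t\<ge>t0. pen (z t) \<le> (f v - f (z t) - D (z t)) * inverse (real (s t))"
    proof (intro exI[of _ 1] allI impI)
      fix t :: nat assume "1 \<le> t"
      then have "0 < real (s t)" using seq_suble[OF s, of t] by simp
      then show "pen (z t) \<le> (f v - f (z t) - D (z t)) * inverse (real (s t))"
        using bound[of t] by (simp add: field_simps)
    qed
  qed
  then have "pen l = 0" using pen_nonneg[of l] by simp
  then have rl: "r j l = 0" if "j < m" for j
    using that by (auto simp: pen_def sum_nonneg_eq_0_iff)
  have "f v \<le> f l"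
  proof (rule min)
    show "l k = v k" if "k \<ge> n" for k
      using l that by (auto simp: S_iff)
    show "g j l = 0" if "j \<in> E" for j
      using rl[of j] that EI by (auto simp: r_def)
    show "g j l \<ge> 0" if "j \<in> I" for j
    proof -
      have "j < m" "j \<notin> E" using that EI by auto
      then show ?thesis using rl[of j] by (simp add: r_def min_def split: if_splits)
    qed
  qed
  moreover have "f l + D l \<le> f v"
  proof (rule LIMSEQ_le_const2)
    show "(\<lambda>t. f (z t) + D (z t)) \<longlonglongrightarrow> f l + D l"
      by (intro tendsto_intros tends[OF cont_f] tends[OF cont_D])
    show "\<exists>t0. \<forall>t\<ge>t0. f (z t) + D (z t) \<le> f v"
    proof (intro exI allI impI)
      fix t
      have "0 \<le> real (s t) * pen (z t)" using pen_nonneg by simp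
      then show "f (z t) + D (z t) \<le> f v" using bound[of t] by linarith
    qed
  qed
  ultimately have "D l = 0" using D_nonneg[of l] by linarith
  then have "l k = v k" if "k < n" for k
    using that by (auto simp: D_def sum_nonneg_eq_0_iff)
  moreover have "l k = v k" if "\<not> k < n" for k
    using l that by (auto simp: S_iff)
  ultimately have "l = v" by (intro ext) blast
  note tends = tends[unfolded \<open>l = v\<close>]
  have coord: "(\<lambda>t. z t k) \<longlonglongrightarrow> v k" for k
    by (rule tends[OF continuous_on_product_coordinates])
  \<comment> \<open>Beyond \<open>pen l = 0\<close>, even the weighted penalty vanishes:
    \<open>bound\<close> squeezes it between 0 and a gap that tends to 0 because \<open>z\<close>
    tends to \<open>v\<close>.\<close>
  have pen0: "(\<lambda>t. real (s t) * pen (z t)) \<longlonglongrightarrow> 0"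
  proof (rule tendsto_sandwich[OF _ _ tendsto_const])
    have "(\<lambda>t. f v - f (z t) - D (z t)) \<longlonglongrightarrow> f v - f v - D v"
      by (intro tendsto_intros tends[OF cont_f] tends[OF cont_D])
    then show "(\<lambda>t. f v - f (z t) - D (z t)) \<longlonglongrightarrow> 0" by (simp add: D_def)
    show "\<forall>\<^sub>F t in sequentially. real (s t) * pen (z t) \<le> f v - f (z t) - D (z t)"
      using bound by (intro always_eventually allI) (simp add: algebra_simps)
    show "\<forall>\<^sub>F t in sequentially. 0 \<le> real (s t) * pen (z t)"
      using pen_nonneg by simp
  qed
  \<comment> \<open>The sign moves the penalty gradient to the other side of the stationarity
    equation, and makes multipliers of inequalities nonnegative as \<open>r \<le> 0\<close>
    there.\<close>
  define mu where "mu t j = - 2 * real (s t) * r j (z t)" for t j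
  \<comment> \<open>Holds for both kinds of constraint, so \<open>g * mu\<close> is controlled by
    the weighted penalty.\<close>
  have gr: "g j x * r j x = (r j x)\<^sup>2" for j x
    by (simp add: r_def min_def power2_eq_square)
  have compl0: "(\<lambda>t. g j (z t) * mu t j) \<longlonglongrightarrow> 0" if "j < m" for j
  proof (rule Lim_null_comparison)
    show "(\<lambda>t. 2 * (real (s t) * pen (z t))) \<longlonglongrightarrow> 0"
      using tendsto_mult_right_zero[OF pen0] .
    show "\<forall>\<^sub>F t in sequentially. norm (g j (z t) * mu t j) \<le> 2 * (real (s t) * pen (z t))"
    proof (intro always_eventually allI)
      fix t
      have "g j (z t) * mu t j = - 2 * real (s t) * (r j (z t))\<^sup>2"
        by (simp add: mu_def flip: gr)
      moreover have "(r j (z t))\<^sup>2 \<le> pen (z t)"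
        unfolding pen_def using that by (intro member_le_sum) auto
      ultimately show "norm (g j (z t) * mu t j) \<le> 2 * (real (s t) * pen (z t))"
        by (simp add: abs_mult mult_left_mono)
    qed
  qed
  \<comment> \<open>Eventually the minimizer is interior in the first \<open>n\<close> coordinates,
    so its partial derivatives there vanish.\<close>
  have "\<forall>\<^sub>F t in sequentially. \<forall>k<n. \<bar>z t k - v k\<bar> < 1"
  proof -
    have "\<forall>\<^sub>F t in sequentially. \<bar>z t k - v k\<bar> < 1" for k
    proof -
      have "(\<lambda>t. \<bar>z t k - v k\<bar>) \<longlonglongrightarrow> \<bar>v k - v k\<bar>"
        by (intro tendsto_intros coord)
      then show ?thesis by (rule order_tendstoD) simp
    qed
    then have "\<forall>\<^sub>F t in sequentially. \<forall>k\<in>{..<n}. \<bar>z t k - v k\<bar> < 1"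
      by (intro eventually_ball_finite) auto
    then show ?thesis by (rule eventually_mono) auto
  qed
  then have stat: "\<forall>\<^sub>F t in sequentially. \<forall>k<n.
      f' k (z t) + 2 * (z t k - v k) = (\<Sum>j<m. mu t j * g' j k (z t))"
  proof eventually_elim
    case (elim t)
    show ?case
    proof (intro allI impI)
      fix k assume k: "k < n"
      have der_r: "((\<lambda>u. (r j ((z t)(k := u)))\<^sup>2) has_field_derivative 2 * r j (z t) * g' j k (z t))
          (at (z t k))" for j
      proof (cases "j \<in> E")
        case True
        have sq: "((\<lambda>u::real. u\<^sup>2) has_field_derivative 2 * b) (at b)" for b
          by (auto intro!: derivative_eq_intros)
        have "((\<lambda>u. (g j ((z t)(k := u)))\<^sup>2) has_field_derivative
            2 * g j ((z t)(k := z t k)) * g' j k (z t)) (at (z t k))"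
          by (rule DERIV_chain2[OF sq der_g])
        then show ?thesis using True by (simp add: r_def)
      next
        case False
        have "((\<lambda>u. (min (g j ((z t)(k := u))) 0)\<^sup>2) has_field_derivative
            2 * min (g j ((z t)(k := z t k))) 0 * g' j k (z t)) (at (z t k))"
          by (rule DERIV_chain2[OF min_zero_power2_has_derivative der_g])
        then show ?thesis using False by (simp add: r_def)
      qed
      have der_D: "((\<lambda>u. D ((z t)(k := u))) has_field_derivative 2 * (z t k - v k)) (at (z t k))"
      proof -
        have "D ((z t)(k := u)) = (u - v k)\<^sup>2 + (\<Sum>i\<in>{..<n} - {k}. (z t i - v i)\<^sup>2)" for u
          unfolding D_def using k by (subst sum.remove[of _ k]) auto
        then show ?thesis by (auto intro!: derivative_eq_intros)
      qed
      have sum_mu: "(\<Sum>j<m. mu t j * g' j k (z t)) = - (real (s t) * (\<Sum>j<m. 2 * r j (z t) * g' j k (z t)))"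
        unfolding sum_distrib_left sum_negf[symmetric] by (intro sum.cong) (auto simp: mu_def)
      have "((\<lambda>u. F (real (s t)) ((z t)(k := u))) has_field_derivative
          f' k (z t) + 2 * (z t k - v k) + real (s t) * (\<Sum>j<m. 2 * r j (z t) * g' j k (z t)))
          (at (z t k))"
        unfolding F_def pen_def
        by (intro DERIV_add der_f der_D DERIV_cmult DERIV_sum der_r)
      then have "f' k (z t) + 2 * (z t k - v k) + real (s t) * (\<Sum>j<m. 2 * r j (z t) * g' j k (z t)) = 0"
      proof (rule DERIV_local_min)
        \<comment> \<open>The radius is the distance of coordinate \<open>k\<close> to the boundary
          of the box.\<close>
        show "0 < 1 - \<bar>z t k - v k\<bar>" using elim k by simp
        show "\<forall>u. \<bar>z t k - u\<bar> < 1 - \<bar>z t k - v k\<bar> \<longrightarrow>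
            F (real (s t)) ((z t)(k := z t k)) \<le> F (real (s t)) ((z t)(k := u))"
        proof (intro allI impI)
          fix u assume u: "\<bar>z t k - u\<bar> < 1 - \<bar>z t k - v k\<bar>"
          have "(z t)(k := u) \<in> S"
            using zS[of t] u k unfolding S_iff by (auto simp: abs_less_iff split: if_splits)
          then show "F (real (s t)) ((z t)(k := z t k)) \<le> F (real (s t)) ((z t)(k := u))"
            using y(2)[of "(z t)(k := u)" "real (s t)"] by (simp add: z_def)
        qed
      qed
      then show "f' k (z t) + 2 * (z t k - v k) = (\<Sum>j<m. mu t j * g' j k (z t))"
        using sum_mu by linarith
    qed
  qed
  have mu_lim: "(\<lambda>t. mu t j) \<longlonglongrightarrow> lam j" if j: "j < m" for j
  proof -
    \<comment> \<open>By stationarity and \<open>left_inv\<close> this sequence eventually equals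
      \<open>mu t j\<close>, while its limit is computed termwise.\<close>
    have "(\<lambda>t. (\<Sum>k<n. h j k (z t) * (f' k (z t) + 2 * (z t k - v k))) +
        (\<Sum>j'<m. h' j j' (z t) * (g j' (z t) * mu t j'))) \<longlonglongrightarrow>
        (\<Sum>k<n. h j k v * (f' k v + 2 * (v k - v k))) + (\<Sum>j'<m. h' j j' v * 0)"
      by (intro tendsto_intros tends[OF cont_h] tends[OF cont_h'] tends[OF cont_f'] compl0 coord) auto
    then have "(\<lambda>t. (\<Sum>k<n. h j k (z t) * (f' k (z t) + 2 * (z t k - v k))) +
        (\<Sum>j'<m. h' j j' (z t) * (g j' (z t) * mu t j'))) \<longlonglongrightarrow> lam j"
      by (simp add: lam_def)
    then show ?thesis
    proof (rule Lim_transform_eventually, use stat in eventually_elim)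
      case (elim t)
      have "(\<Sum>k<n. h j k (z t) * (f' k (z t) + 2 * (z t k - v k))) +
          (\<Sum>j'<m. h' j j' (z t) * (g j' (z t) * mu t j')) =
          (\<Sum>k<n. h j k (z t) * (\<Sum>j'<m. mu t j' * g' j' k (z t))) +
          (\<Sum>j'<m. h' j j' (z t) * (g j' (z t) * mu t j'))"
        using elim by simp
      also have "(\<Sum>k<n. h j k (z t) * (\<Sum>j'<m. mu t j' * g' j' k (z t))) =
          (\<Sum>j'<m. (\<Sum>k<n. h j k (z t) * g' j' k (z t)) * mu t j')"
        unfolding sum_distrib_left sum_distrib_right by (subst sum.swap) (simp add: mult_ac)
      also have "\<dots> + (\<Sum>j'<m. h' j j' (z t) * (g j' (z t) * mu t j')) =
          (\<Sum>j'<m. ((\<Sum>k<n. h j k (z t) * g' j' k (z t)) + h' j j' (z t) * g j' (z t)) * mu t j')"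
        unfolding sum.distrib[symmetric] by (intro sum.cong) (auto simp: algebra_simps)
      also have "\<dots> = (\<Sum>j'<m. (if j = j' then 1 else 0) * mu t j')"
        by (intro sum.cong refl) (simp only: left_inv[OF j] lessThan_iff)
      also have "\<dots> = (\<Sum>j'<m. if j = j' then mu t j' else 0)"
        by (intro sum.cong) auto
      also have "\<dots> = mu t j" using j by simp
      finally show ?case .
    qed
  qed
  show "f' k v - (\<Sum>j<m. lam j * g' j k v) = 0" if "k < n" for k
  proof -
    have "(\<lambda>t. f' k (z t) + 2 * (z t k - v k) - (\<Sum>j<m. mu t j * g' j k (z t))) \<longlonglongrightarrow>
        f' k v + 2 * (v k - v k) - (\<Sum>j<m. lam j * g' j k v)"
      by (intro tendsto_intros tends[OF cont_f'] tends[OF cont_g'] mu_lim coord) auto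
    moreover have "(\<lambda>t. f' k (z t) + 2 * (z t k - v k) - (\<Sum>j<m. mu t j * g' j k (z t))) \<longlonglongrightarrow> 0"
      by (rule tendsto_eventually, use stat in eventually_elim) (use that in auto)
    ultimately show ?thesis using LIMSEQ_unique by fastforce
  qed
  fix j assume "j \<in> I"
  then have j: "j < m" "j \<notin> E" using EI by auto
  show "lam j \<ge> 0"
  proof (rule LIMSEQ_le_const[OF mu_lim[OF j(1)]])
    show "\<exists>t0. \<forall>t\<ge>t0. 0 \<le> mu t j"
      using j by (auto simp: mu_def r_def mult_nonneg_nonpos)
  qed
  have "(\<lambda>t. g j (z t) * mu t j) \<longlonglongrightarrow> g j v * lam j"
    by (intro tendsto_mult tends[OF cont_g] mu_lim j)
  from LIMSEQ_unique[OF this compl0[OF j(1)]] show "lam j * g j v = 0"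
    by (simp add: mult.commute)
qed

section \<open>Left inverses and multiplier expressions in coordinates\<close>

lemma sum_lessThan_add: "(\<Sum>r<a + b. F r) = (\<Sum>r<a. F r) + (\<Sum>r<b. F (a + r :: nat))"
  for F :: "nat \<Rightarrow> 'a::comm_monoid_add"
  by (induction b) (auto simp: add.assoc)

lemma left_inverses_eval:
  assumes H: "left_inverses P H" and i: "i < players P" and j: "j < ncons P i" "j' < ncons P i"
  shows "(\<Sum>k<sdim P i. mp_eval x (H i $$ (j, k)) * mp_eval x (mp_deriv k (constr P i j'))) +
    mp_eval x (H i $$ (j, sdim P i + j')) * mp_eval x (constr P i j') = (if j = j' then 1 else 0)"
proof -
  let ?n = "sdim P i" and ?m = "ncons P i"
  have carrier: "H i \<in> carrier_mat ?m (?n + ?m)" and inv: "H i * constr_matrix P i = 1\<^sub>m ?m"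
    using H i by (auto simp: left_inverses_def)
  have "(H i * constr_matrix P i) $$ (j, j') = (\<Sum>r<?n + ?m. H i $$ (j, r) * constr_matrix P i $$ (r, j'))"
    using carrier j by (simp add: constr_matrix_def scalar_prod_def atLeast0LessThan)
  \<comment> \<open>Of the diagonal block, column \<open>j'\<close> has only one nonzero
    position.\<close>
  also have "\<dots> = (\<Sum>k<?n. H i $$ (j, k) * mp_deriv k (constr P i j')) +
      (\<Sum>r<?m. if r = j' then H i $$ (j, ?n + j') * constr P i j' else 0)"
    unfolding sum_lessThan_add using j
    by (intro arg_cong2[of _ _ _ _ "(+)"] sum.cong) (auto simp: constr_matrix_def)
  also have "\<dots> = (\<Sum>k<?n. H i $$ (j, k) * mp_deriv k (constr P i j')) +
      H i $$ (j, ?n + j') * constr P i j'"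
    using j by simp
  finally have "(\<Sum>k<?n. H i $$ (j, k) * mp_deriv k (constr P i j')) +
      H i $$ (j, ?n + j') * constr P i j' = (if j = j' then 1 else 0)"
    using inv j by simp
  then have "mp_eval x ((\<Sum>k<?n. H i $$ (j, k) * mp_deriv k (constr P i j')) +
      H i $$ (j, ?n + j') * constr P i j') = mp_eval x (if j = j' then 1 else 0)"
    by simp
  then show ?thesis
    by (simp add: mp_eval_add mp_eval_sum mp_eval_mult split: if_splits)
qed

text \<open>The zero padding of the gradient cancels the last \<open>ncons P i\<close> columns of
  \<open>H i\<close>.\<close>

lemma multipliers_eq:
  assumes "H i \<in> carrier_mat (ncons P i) (sdim P i + ncons P i)" "j < ncons P i"
  shows "multipliers P H i x $ j = (\<Sum>k<sdim P i. block_eval (x i) (H i $$ (j, k)) * own_gradient P i x $ k)"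
  using assms
  by (simp add: multipliers_def scalar_prod_def atLeast0LessThan sum_lessThan_add own_gradient_def)

text \<open>With the other players frozen, each block of an equilibrium solves a constrained
  minimization. The left inverse plays the part of a constraint qualification through
  \<open>minimizer_multipliers\<close>.\<close>

theorem nash_equilibrium_imp_kkt_point:
  assumes H: "left_inverses P H"
    and EI: "\<And>i. i < players P \<Longrightarrow> eqs P i \<union> ineqs P i = {..<ncons P i}"
      "\<And>i. i < players P \<Longrightarrow> eqs P i \<inter> ineqs P i = {}"
    and vars: "\<And>i. i < players P \<Longrightarrow> mp_vars (objective P i) \<subseteq> Sigma {..<players P} (\<lambda>j. {..<sdim P j})"
      "\<And>i j. i < players P \<Longrightarrow> j < ncons P i \<Longrightarrow> mp_vars (constr P i j) \<subseteq> {..<sdim P i}"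
    and ne: "nash_equilibrium P x"
  shows "kkt_point P H x"
proof -
  have "(\<forall>k<sdim P i. own_gradient P i x $ k -
           (\<Sum>j<ncons P i. multipliers P H i x $ j * block_eval (x i) (mp_deriv k (constr P i j))) = 0) \<and>
        (\<forall>j\<in>eqs P i. block_eval (x i) (constr P i j) = 0) \<and>
        (\<forall>j\<in>ineqs P i. multipliers P H i x $ j * block_eval (x i) (constr P i j) = 0 \<and>
           block_eval (x i) (constr P i j) \<ge> 0 \<and> multipliers P H i x $ j \<ge> 0)"
    if i: "i < players P" for i
  proof -
    let ?n = "sdim P i" and ?m = "ncons P i"
    \<comment> \<open>Block \<open>i\<close> is replaced by a total function on \<open>nat\<close>,
      the form in which partial derivatives and compactness are available.\<close>
    define ext where "ext y = (\<lambda>(j, k). if j = i then y k else x j $ k)" for y :: "nat \<Rightarrow> real"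
    define f where "f y = mp_eval (ext y) (objective P i)" for y
    define f' where "f' k y = mp_eval (ext y) (mp_deriv (i, k) (objective P i))" for k y
    define g where "g j y = mp_eval y (constr P i j)" for j and y :: "nat \<Rightarrow> real"
    define g' where "g' j k y = mp_eval y (mp_deriv k (constr P i j))" for j k and y :: "nat \<Rightarrow> real"
    define h where "h j k y = mp_eval y (H i $$ (j, k))" for j k and y :: "nat \<Rightarrow> real"
    define h' where "h' j j' y = mp_eval y (H i $$ (j, ?n + j'))" for j j' and y :: "nat \<Rightarrow> real"
    define v where "v = (\<lambda>k. x i $ k)"
    have feas: "x i \<in> feasible_set P i"
      and opt: "\<And>w. w \<in> feasible_set P i \<Longrightarrow>
        profile_eval x (objective P i) \<le> profile_eval (x(i := w)) (objective P i)"
      using ne i by (auto simp: nash_equilibrium_def)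
    have ext_v: "ext v = (\<lambda>(j, k). x j $ k)" by (auto simp: ext_def v_def)
    have ext_upd: "ext (y(k := t)) = (ext y)((i, k) := t)" for y k t
      by (auto simp: ext_def)
    have cont_ext: "continuous_on UNIV (\<lambda>y. ext y u)" for u
      by (cases u; cases "fst u = i") (auto simp: ext_def)
    note EI = EI[OF i]
    have cont: "continuous_on UNIV f" "\<And>j. continuous_on UNIV (g j)" "\<And>k. continuous_on UNIV (f' k)"
      "\<And>j k. continuous_on UNIV (g' j k)" "\<And>j k. continuous_on UNIV (h j k)"
      "\<And>j k. continuous_on UNIV (h' j k)"
      unfolding f_def g_def f'_def g'_def h_def h'_def
      by (intro continuous_on_mp_eval cont_ext continuous_on_product_coordinates)+
    have "((\<lambda>t. f (y(k := t))) has_field_derivative f' k y) (at (y k))" for k y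
    proof -
      have "ext y (i, k) = y k" by (simp add: ext_def)
      then show ?thesis
        using mp_eval_has_field_derivative[of "ext y" "(i, k)" "objective P i"]
        by (simp add: f_def f'_def ext_upd)
    qed
    have "((\<lambda>t. g j (y(k := t))) has_field_derivative g' j k y) (at (y k))" for j k y
      unfolding g_def g'_def by (rule mp_eval_has_field_derivative)
    have "(\<Sum>k<?n. h j k y * g' j' k y) + h' j j' y * g j' y = (if j = j' then 1 else 0)"
      if "j < ?m" "j' < ?m" for y j j'
      unfolding h_def h'_def g_def g'_def using left_inverses_eval[OF H i that] .
    have "g j v = 0" if "j \<in> eqs P i" for j
      using feas that by (simp add: feasible_set_def g_def v_def)
    have "g j v \<ge> 0" if "j \<in> ineqs P i" for j
      using feas that by (simp add: feasible_set_def g_def v_def)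
    have "f v \<le> f y"
      if "\<And>k. k \<ge> ?n \<Longrightarrow> y k = v k" "\<And>j. j \<in> eqs P i \<Longrightarrow> g j y = 0"
        "\<And>j. j \<in> ineqs P i \<Longrightarrow> g j y \<ge> 0" for y
    proof -
      \<comment> \<open>Truncating \<open>y\<close> to its first \<open>?n\<close> coordinates
        changes no constraint value, since the constraints contain only those variables.\<close>
      have g_vec: "block_eval (vec ?n y) (constr P i j) = g j y" if "j \<in> eqs P i \<union> ineqs P i" for j
        unfolding g_def using vars(2)[OF i, of j] that EI(1) by (intro mp_eval_cong) auto
      have "vec ?n y \<in> feasible_set P i"
        using that g_vec by (auto simp: feasible_set_def)
      from opt[OF this] have "f v \<le> profile_eval (x(i := vec ?n y)) (objective P i)"
        by (simp add: f_def ext_v)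
      also have "\<dots> = f y"
        unfolding f_def using vars(1)[OF i] by (intro mp_eval_cong) (auto simp: ext_def)
      finally show ?thesis .
    qed
    note lagrange = minimizer_multipliers[of f g f' g' h h' ?m ?n "eqs P i" "ineqs P i" v]
    have kkt: "f' k v - (\<Sum>j<?m. (\<Sum>k<?n. h j k v * f' k v) * g' j k v) = 0" if "k < ?n" for k
      by (rule lagrange) fact+
    have kkt': "(\<Sum>k<?n. h j k v * f' k v) \<ge> 0" if "j \<in> ineqs P i" for j
      by (rule lagrange) fact+
    have kkt'': "(\<Sum>k<?n. h j k v * f' k v) * g j v = 0" if "j \<in> ineqs P i" for j
      by (rule lagrange) fact+
    have grad: "own_gradient P i x $ k = f' k v" if "k < ?n" for k
      using that by (simp add: own_gradient_def f'_def ext_v)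
    have mult: "multipliers P H i x $ j = (\<Sum>k<?n. h j k v * f' k v)" if "j < ?m" for j
      using multipliers_eq[of H i P j x] H i that grad by (simp add: left_inverses_def h_def v_def)
    have ineq: "j < ?m" if "j \<in> ineqs P i" for j using EI(1) that by auto
    show ?thesis
    proof (intro conjI allI ballI impI)
      fix k assume k: "k < ?n"
      have "(\<Sum>j<?m. multipliers P H i x $ j * block_eval (x i) (mp_deriv k (constr P i j))) =
          (\<Sum>j<?m. (\<Sum>k<?n. h j k v * f' k v) * g' j k v)"
        by (intro sum.cong) (auto simp: mult g'_def v_def)
      then show "own_gradient P i x $ k -
          (\<Sum>j<?m. multipliers P H i x $ j * block_eval (x i) (mp_deriv k (constr P i j))) = 0"
        using kkt[OF k] grad[OF k] by simp
    next
      fix j assume j: "j \<in> ineqs P i"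
      show "multipliers P H i x $ j * block_eval (x i) (constr P i j) = 0"
        using kkt''[OF j] mult[OF ineq[OF j]] by (simp add: g_def v_def)
      show "multipliers P H i x $ j \<ge> 0"
        using kkt'[OF j] mult[OF ineq[OF j]] by simp
    qed (use feas in \<open>auto simp: feasible_set_def\<close>)
  qed
  moreover have "x \<in> profiles P" using ne by (simp add: nash_equilibrium_def)
  ultimately show ?thesis by (simp add: kkt_point_def)
qed

section \<open>Termination and correctness of the algorithm\<close>

lemma kkt_point_feasible:
  assumes "kkt_point P H x" "i < players P"
  shows "x i \<in> feasible_set P i"
  using assms by (auto simp: kkt_point_def feasible_set_def profiles_def)

lemma L_value_eq:
  assumes "v \<in> L_optimizers P u i"
  shows "L_value P u i = L_objective P u i v"
  unfolding L_value_def using assms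
  by (intro cInf_eq_minimum) (auto simp: L_optimizers_def)

section \<open>Invariant and decreasing rank of a run\<close>

fun alg_inv :: "poly_nep \<Rightarrow> (nat \<Rightarrow> (nat, real) mpoly mat) \<Rightarrow> alg_state \<Rightarrow> bool" where
  "alg_inv P H (Step1 l K) \<longleftrightarrow> (\<forall>i<players P. K i \<subseteq> feasible_set P i)"
| "alg_inv P H (Step2 l K u) \<longleftrightarrow> (\<forall>i<players P. K i \<subseteq> feasible_set P i) \<and> U_feasible P H K u"
| "alg_inv P H (FoundNE u) \<longleftrightarrow> nash_equilibrium P u"
| "alg_inv P H NoNE \<longleftrightarrow> \<not> (\<exists>x. nash_equilibrium P x)"

text \<open>The factor 2 and the extra 1 in Step 1 make the rank drop on optimization, where the
  feasible set stays the same, and still drop on refinement, where at least one point is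
  lost.\<close>

fun alg_rank :: "poly_nep \<Rightarrow> (nat \<Rightarrow> (nat, real) mpoly mat) \<Rightarrow> alg_state \<Rightarrow> nat" where
  "alg_rank P H (Step1 l K) = 2 * card {x. U_feasible P H K x} + 1"
| "alg_rank P H (Step2 l K u) = 2 * card {x. U_feasible P H K x}"
| "alg_rank P H (FoundNE u) = 0"
| "alg_rank P H NoNE = 0"

lemma alg_step_inv:
  assumes nk: "\<And>x. nash_equilibrium P x \<Longrightarrow> kkt_point P H x"
    and step: "alg_step P H \<Theta> s s'" and inv: "alg_inv P H s"
  shows "alg_inv P H s'"
  using step inv
proof cases
  case (infeasible K l)
  \<comment> \<open>An equilibrium satisfies (K) by \<open>nk\<close>, and all cuts because the sets
    \<open>K i\<close> consist of feasible strategies.\<close>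
  have False if "nash_equilibrium P x" for x
  proof -
    have "U_feasible P H K x"
      using nk[OF that] that inv infeasible(1) by (auto simp: U_feasible_def nash_equilibrium_def)
    then show False using infeasible by blast
  qed
  then show ?thesis using infeasible by auto
next
  case (optimize K u l)
  then show ?thesis using inv by (auto simp: U_optimizer_def)
next
  case (accept u l K)
  have kkt: "kkt_point P H u" using inv accept by (auto simp: U_feasible_def)
  have "profile_eval u (objective P i) \<le> profile_eval (u(i := v)) (objective P i)"
    if i: "i < players P" and v: "v \<in> feasible_set P i" for i v
  proof -
    obtain w where w: "w \<in> L_optimizers P u i" using accept i by (auto simp: L_solvable_def)
    have "0 \<le> L_value P u i" using accept i by blast
    also have "\<dots> = L_objective P u i w" using w by (rule L_value_eq)
    also have "\<dots> \<le> L_objective P u i v" using w v by (simp add: L_optimizers_def)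
    finally show ?thesis by (simp add: L_objective_def)
  qed
  then show ?thesis
    using kkt kkt_point_feasible[OF kkt] accept by (auto simp: nash_equilibrium_def kkt_point_def)
next
  case (refine u U l K)
  then show ?thesis using inv by (fastforce simp: L_optimizers_def)
qed

lemma alg_step_rank:
  assumes fin: "finite {x. kkt_point P H x}"
    and step: "alg_step P H \<Theta> s s'" and inv: "alg_inv P H s"
  shows "alg_rank P H s' < alg_rank P H s"
proof -
  have finU: "finite {x. U_feasible P H K x}" for K
    using fin by (rule finite_subset[rotated]) (auto simp: U_feasible_def)
  show ?thesis
    using step
  proof cases
    case (accept u l K)
    \<comment> \<open>The current point keeps the rank positive before acceptance brings it to
      0.\<close>
    then have "u \<in> {x. U_feasible P H K x}" using inv by simp
    then show ?thesis using accept finU card_gt_0_iff by fastforce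
  next
    case (refine u U l K)
    let ?K = "\<lambda>i. if i < players P \<and> L_value P u i < 0 then K i \<union> U i else K i"
    obtain i where i: "i < players P" "L_value P u i < 0" using refine by blast
    then obtain v where v: "v \<in> U i" "v \<in> L_optimizers P u i" using refine by blast
    \<comment> \<open>A new cut at an optimizer of negative value excludes the current
      \<open>u\<close>.\<close>
    have "\<not> U_feasible P H ?K u"
    proof
      assume "U_feasible P H ?K u"
      then have "0 \<le> L_objective P u i v" using i v by (auto simp: U_feasible_def L_objective_def)
      then show False using i L_value_eq[OF v(2)] by simp
    qed
    moreover have "U_feasible P H K u" using inv refine by simp
    moreover have "{x. U_feasible P H ?K x} \<subseteq> {x. U_feasible P H K x}"
      by (auto simp: U_feasible_def split: if_splits)
    ultimately have "{x. U_feasible P H ?K x} \<subset> {x. U_feasible P H K x}" by blast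
    then have "card {x. U_feasible P H ?K x} < card {x. U_feasible P H K x}"
      by (rule psubset_card_mono[OF finU])
    then show ?thesis unfolding refine by simp
  qed auto
qed

theorem alg_terminates_if_finite_kkt_points:
  assumes fin: "finite {x. kkt_point P H x}"
    and nk: "\<And>x. nash_equilibrium P x \<Longrightarrow> kkt_point P H x"
  shows "alg_terminates P H \<Theta>"
  unfolding alg_terminates_def
proof
  assume "\<exists>\<sigma>. \<sigma> 0 = alg_init \<and> (\<forall>t. alg_step P H \<Theta> (\<sigma> t) (\<sigma> (Suc t)))"
  then obtain \<sigma> where \<sigma>: "\<sigma> 0 = alg_init" "\<And>t. alg_step P H \<Theta> (\<sigma> t) (\<sigma> (Suc t))" by blast
  have inv: "alg_inv P H (\<sigma> t)" for t
    by (induction t) (use \<sigma> alg_step_inv[OF nk] in \<open>auto simp: alg_init_def\<close>)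
  have "alg_rank P H (\<sigma> t) + t \<le> alg_rank P H (\<sigma> 0)" for t
  proof (induction t)
    case (Suc t)
    then show ?case using alg_step_rank[OF fin \<sigma>(2) inv, of t] by simp
  qed simp
  \<comment> \<open>The rank decreases at every step, so no run is longer than its initial
    rank.\<close>
  from this[of "Suc (alg_rank P H (\<sigma> 0))"] show False by simp
qed

theorem alg_correct_if_finite_kkt_points:
  assumes fin: "finite {x. kkt_point P H x}"
    and nk: "\<And>x. nash_equilibrium P x \<Longrightarrow> kkt_point P H x"
  shows "alg_correct P H \<Theta>"
  unfolding alg_correct_def
proof (intro allI impI, elim conjE)
  fix s assume reach: "(alg_step P H \<Theta>)\<^sup>*\<^sup>* alg_init s" and stuck: "\<not> (\<exists>s'. alg_step P H \<Theta> s s')"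
  from reach have inv: "alg_inv P H s"
    by (induction rule: rtranclp_induct) (auto simp: alg_init_def intro: alg_step_inv[OF nk])
  show "case s of FoundNE u \<Rightarrow> nash_equilibrium P u
           | NoNE \<Rightarrow> \<not> (\<exists>x. nash_equilibrium P x)
           | Step2 l K u \<Rightarrow> \<not> L_solvable P u
           | Step1 l K \<Rightarrow> False"
  proof (cases s)
    case (Step1 l K)
    let ?F = "{x. U_feasible P H K x}"
    have "finite ?F"
      using fin by (rule finite_subset[rotated]) (auto simp: U_feasible_def)
    have "?F \<noteq> {}" using stuck Step1 alg_step.infeasible by blast
    \<comment> \<open>A finite nonempty feasible set has a minimizer of any objective, so Step 1 is
      never stuck.\<close>
    define u where "u = arg_min_on (U_objective P \<Theta>) ?F"
    have "u \<in> ?F" "\<forall>x\<in>?F. U_objective P \<Theta> u \<le> U_objective P \<Theta> x"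
      unfolding u_def
      using arg_min_if_finite[OF \<open>finite ?F\<close> \<open>?F \<noteq> {}\<close>, of "U_objective P \<Theta>"]
      by (auto simp: not_less)
    then have "U_optimizer P H \<Theta> K u" by (simp add: U_optimizer_def)
    then show ?thesis using stuck Step1 alg_step.optimize by blast
  next
    case (Step2 l K u)
    have False if solv: "L_solvable P u"
    proof (cases "\<forall>i<players P. L_value P u i \<ge> 0")
      case True
      then show ?thesis using stuck Step2 alg_step.accept[OF solv] by blast
    next
      case False
      \<comment> \<open>One optimizer per player is a legitimate choice of the refinement
        sets.\<close>
      define U where "U i = {SOME v. v \<in> L_optimizers P u i}" for i
      have "(SOME v. v \<in> L_optimizers P u i) \<in> L_optimizers P u i" if "i < players P" for i
        using solv that by (simp add: some_in_eq L_solvable_def)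
      then have "\<forall>i<players P. L_value P u i < 0 \<longrightarrow> finite (U i) \<and> U i \<noteq> {} \<and> U i \<subseteq> L_optimizers P u i"
        by (auto simp: U_def)
      moreover have "\<exists>i<players P. L_value P u i < 0" using False by (auto simp: not_le)
      ultimately show ?thesis using stuck Step2 alg_step.refine[OF solv] by blast
    qed
    then show ?thesis using Step2 by auto
  qed (use inv in auto)
qed

theorem theorem3p3:
  fixes N :: nat and n m :: "nat \<Rightarrow> nat" and E I :: "nat \<Rightarrow> nat set"
    and d a :: "nat \<Rightarrow> nat \<Rightarrow> nat"
  assumes "\<And>i. i < N \<Longrightarrow> E i \<union> I i = {..<m i}"
    and "\<And>i. i < N \<Longrightarrow> E i \<inter> I i = {}"
    and "\<And>i j. i < N \<Longrightarrow> j < m i \<Longrightarrow> d i j > 0"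
    and "\<And>i j. i < N \<Longrightarrow> j < N \<Longrightarrow> a i j > 0"
  shows "AE c in coeff_measure N n m d a.
    let P = nep_of_coeffs N n m E I d a c in
      \<forall>H. left_inverses P H \<longrightarrow>
        (AE \<theta> in sym_measure (total_dim P + 1).
          let \<Theta> = sym_mat (total_dim P + 1) \<theta> in
            pos_definite \<Theta> \<longrightarrow> alg_terminates P H \<Theta> \<and> alg_correct P H \<Theta>)"
proof -
  have a: "\<And>i. i < N \<Longrightarrow> a i i > 0" using assms(4) by blast
  have "AE c in coeff_measure N n m d a.
      \<forall>H. finite {x. kkt_point (nep_of_coeffs N n m E I d a c) H x}"
    using assms(1) a by (rule AE_finite_kkt_points)
  then show ?thesis
  proof eventually_elim
    case (elim c)
    define P where "P = nep_of_coeffs N n m E I d a c"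
    have fin: "finite {x. kkt_point P H x}" for H
      using elim by (simp add: P_def)
    have P: "players P = N" "sdim P = n" "ncons P = m" "eqs P = E" "ineqs P = I"
      "\<And>i. objective P i = (\<Sum>\<mu>\<in>f_monomials N n a i. Poly_Mapping.single \<mu> (c (FCoeff i \<mu>)))"
      "\<And>i j. constr P i j = (\<Sum>\<mu>\<in>g_monomials n d i j. Poly_Mapping.single \<mu> (c (GCoeff i j \<mu>)))"
      by (simp_all add: P_def nep_of_coeffs_def)
    \<comment> \<open>The monomial sets from which the data are built keep each polynomial in its
      own variables, as the necessity of (K) requires.\<close>
    have "mp_vars (objective P i) \<subseteq> Sigma {..<players P} (\<lambda>j. {..<sdim P j})" for i
      using keys_sum_single[OF finite_f_monomials[of N n a i], of "\<lambda>\<mu>. c (FCoeff i \<mu>)"]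
      unfolding mp_vars_def P by (fastforce simp: f_monomials_def)
    moreover have "mp_vars (constr P i j) \<subseteq> {..<sdim P i}" for i j
      using keys_sum_single[OF finite_g_monomials[of n d i j], of "\<lambda>\<mu>. c (GCoeff i j \<mu>)"]
      unfolding mp_vars_def P by (fastforce simp: g_monomials_def)
    moreover have "eqs P i \<union> ineqs P i = {..<ncons P i}" "eqs P i \<inter> ineqs P i = {}"
      if "i < players P" for i
      using assms(1,2)[of i] that by (simp_all add: P(1-5))
    ultimately have nk: "kkt_point P H x" if "left_inverses P H" "nash_equilibrium P x" for H x
      using that nash_equilibrium_imp_kkt_point[of P H x] by blast
    show ?case
      unfolding Let_def P_def[symmetric]
      using alg_terminates_if_finite_kkt_points[OF fin nk] alg_correct_if_finite_kkt_points[OF fin nk]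
      by auto
  qed
qed

end
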